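(* Let $q$ be a complex number with $|q|<1$ and let $m$ be a nonnegative integer. Then \[ \sum_{j,\,k,\,\ell\,\geq0}\frac{(q;q^2)_k(-1)^{k}}{(q;q)_{2j}(q^2;q^2)_k(q^2;q^2)_{\ell}} q^{(2j+k+\ell)(2j+k+\ell-1)+\ell^2+j+k-2m(j+\ell)} =\frac{(-q^{-m};q)_m(q^8,-q^3,-q^5;q^8)_{\infty}}{(q^2;q^2)_{\infty}}, \] \[ \sum_{j,\,k,\,\ell\,\geq0}\frac{(q;q^2)_k(-1)^{k}}{(q;q)_{1+2j}(q^2;q^2)_k(q^2;q^2)_{\ell}} q^{(1+2j+k+\ell)(2j+k+\ell)+\ell^2+j+k-m(1+2j+2\ell)} =\frac{(-q^{-m};q)_m(q^8,-q,-q^7;q^8)_{\infty}}{(q^2;q^2)_{\infty}}. \]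
   Context: For complex $a$ and $|q|<1$, $(a;q)_\infty=\prod_{i=0}^{\infty}(1-aq^i)$, $(a;q)_n=(a;q)_\infty/(aq^n;q)_\infty$ for nonnegative integers $n$, and $(a_1,\dots,a_r;q)_\infty=(a_1;q)_\infty\cdots(a_r;q)_\infty$. *)

theory Defs
  imports "HOL-Analysis.Analysis"
begin

text \<open>
  The q-Pochhammer symbols below are meant for base \<open>norm q < 1\<close>, where the infinite products
  converge. The value of \<open>prodinf\<close> is \<open>0\<close> as soon as one of the factors vanishes.
\<close>

definition qpoch_inf :: "complex \<Rightarrow> complex \<Rightarrow> complex" where
  "qpoch_inf a q = (\<Prod>i. 1 - a * q ^ i)"

text \<open>The quotient is meaningful when \<open>a * q ^ i \<noteq> 1\<close> for all \<open>i \<ge> n\<close>.\<close>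

definition qpoch :: "complex \<Rightarrow> complex \<Rightarrow> nat \<Rightarrow> complex" where
  "qpoch a q n = qpoch_inf a q / qpoch_inf (a * q ^ n) q"

definition qpochs_inf :: "complex list \<Rightarrow> complex \<Rightarrow> complex" where
  "qpochs_inf as q = (\<Prod>a\<leftarrow>as. qpoch_inf a q)"

end

theory Submission
  imports Defs
begin

text \<open>
  Sum over \<open>k\<close> first, and collect the terms with \<open>j + l = J\<close>. The sums over \<open>k\<close> are the series
  \<open>t M = (\<Sum>k. (q;q\<^sup>2)\<^sub>k (-1)^k q^(k\<^sup>2 + 2kM) / (q\<^sup>2;q\<^sup>2)\<^sub>k)\<close>, which satisfy
  \<open>t M = (1 - q^(2M+1)) t (M+1) + q^(2M+2) t (M+2)\<close>. This recurrence collapses the finite sum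
  over \<open>l \<le> J\<close> to a multiple of \<open>t 0\<close> (first identity) or of \<open>t 1\<close> (second identity), with
  factor \<open>q^(n(n-1)/2) q^(-mn) / (q;q)\<^sub>n\<close> where \<open>n = 2J\<close> or \<open>n = 2J + 1\<close>. The sum over \<open>J\<close> is
  the even or odd part of Euler's series for \<open>(-q^(-m);q)\<^sub>\<infinity>\<close>, and both parts equal half of it
  because \<open>(q^(-m);q)\<^sub>\<infinity> = 0\<close>.

  With \<open>x\<^sup>2 = q\<close>, the values \<open>t 0\<close> and \<open>x t 1\<close> are \<open>(q;q\<^sup>2)\<^sub>\<infinity>\<close> times the even and odd parts
  of \<open>(-x;q)\<^sub>\<infinity>\<close> in \<open>x\<close>. Since \<open>(-x;q)\<^sub>\<infinity> = (-x;q\<^sup>2)\<^sub>\<infinity> (-q\<^sup>2/x;q\<^sup>2)\<^sub>\<infinity>\<close>, these parts are the even and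
  odd halves of a theta series, and Jacobi's triple product turns each half back into a product.
\<close>

section \<open>Unconditional sums\<close>

lemma summable_norm_on_times:
  fixes f :: "'a \<Rightarrow> complex" and g :: "'b \<Rightarrow> complex"
  assumes "(\<lambda>x. norm (f x)) summable_on A" "(\<lambda>y. norm (g y)) summable_on B"
  shows "(\<lambda>(x, y). norm (f x * g y)) summable_on A \<times> B"
proof -
  have "(\<lambda>z. norm (f (fst z)) * norm (g (snd z))) summable_on A \<times> B"
  proof (rule summable_on_SigmaI)
    show "((\<lambda>y. norm (f (fst (x, y))) * norm (g (snd (x, y)))) has_sum
            norm (f x) * infsum (\<lambda>y. norm (g y)) B) B" for x
      using has_sum_cmult_right[OF has_sum_infsum[OF assms(2)]] by simp
    show "(\<lambda>x. norm (f x) * infsum (\<lambda>y. norm (g y)) B) summable_on A"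
      by (intro summable_on_cmult_left assms)
  qed auto
  then show ?thesis
    by (simp add: case_prod_unfold norm_mult)
qed

text \<open>Both orders of summation compute the unconditional sum over the product set, so the
  value \<open>S\<close> found by columns is also the value by rows.\<close>

lemma has_sum_swap_complex:
  fixes f :: "'a \<times> 'b \<Rightarrow> complex"
  assumes "f summable_on A \<times> B"
    and row: "\<And>x. x \<in> A \<Longrightarrow> ((\<lambda>y. f (x, y)) has_sum g x) B"
    and col: "\<And>y. y \<in> B \<Longrightarrow> ((\<lambda>x. f (x, y)) has_sum h y) A"
    and h: "(h has_sum S) B"
  shows "(g has_sum S) A"
proof -
  have f: "(f has_sum infsum f (A \<times> B)) (A \<times> B)"
    using assms(1) by simp
  have "((\<lambda>(y, x). f (x, y)) has_sum infsum f (A \<times> B)) (B \<times> A)"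
    using f by (subst has_sum_reindex_bij_witness[of _ prod.swap prod.swap]) auto
  then have "(h has_sum infsum f (A \<times> B)) B"
    by (rule has_sum_SigmaD) (use col in auto)
  with h have "infsum f (A \<times> B) = S"
    by (metis has_sum_unique)
  with f row show ?thesis
    using has_sum_SigmaD by blast
qed

text \<open>Averaging \<open>f\<close> with its sign-twisted copy kills the odd terms; taking half
  the difference kills the even ones. The index type is general because both Euler's series over the
  naturals and theta series over the integers are split this way.\<close>

lemma has_sum_even_odd:
  fixes f :: "'a :: {semiring_parity, semiring_char_0, semiring_no_zero_divisors_cancel} \<Rightarrow> complex"
  assumes A: "(f has_sum A) UNIV"
    and B: "((\<lambda>n. if even n then f n else - f n) has_sum B) UNIV"
  shows "((\<lambda>n. f (2 * n)) has_sum (A + B) / 2) UNIV"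
    and "((\<lambda>n. f (2 * n + 1)) has_sum (A - B) / 2) UNIV"
proof -
  have "((\<lambda>n. (f n + (if even n then f n else - f n)) / 2) has_sum (A + B) / 2) UNIV"
    by (intro has_sum_divide_const has_sum_add A B)
  also have "?this \<longleftrightarrow> (f has_sum (A + B) / 2) {n. even n}"
    by (rule has_sum_cong_neutral) auto
  also have "{n :: 'a. even n} = range (\<lambda>n. 2 * n)"
    by (auto simp: dvd_def)
  finally show "((\<lambda>n. f (2 * n)) has_sum (A + B) / 2) UNIV"
    by (subst (asm) has_sum_reindex) (auto simp: o_def inj_on_def)
  have "((\<lambda>n. (f n - (if even n then f n else - f n)) / 2) has_sum (A - B) / 2) UNIV"
    using has_sum_divide_const[OF has_sum_add[OF A has_sum_uminusI[OF B]]] by simp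
  also have "?this \<longleftrightarrow> (f has_sum (A - B) / 2) {n. odd n}"
    by (rule has_sum_cong_neutral) auto
  also have "{n :: 'a. odd n} = range (\<lambda>n. 2 * n + 1)"
    by (auto elim: oddE)
  finally show "((\<lambda>n. f (2 * n + 1)) has_sum (A - B) / 2) UNIV"
    by (subst (asm) has_sum_reindex) (auto simp: o_def inj_on_def)
qed

text \<open>The ratio of consecutive terms is \<open>s * r ^ n\<close>, which tends to 0 however
  large \<open>s\<close> is. This freedom in \<open>s\<close> later absorbs negative powers of
  \<open>q\<close>.\<close>

lemma summable_gaussian:
  fixes r s :: real
  assumes "0 \<le> r" "r < 1" "0 \<le> s"
  shows "summable (\<lambda>n. s ^ n * r ^ (n choose 2))"
proof -
  have "(\<lambda>n. s * r ^ n) \<longlonglongrightarrow> s * 0"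
    by (intro tendsto_intros LIMSEQ_realpow_zero assms)
  then have "eventually (\<lambda>n. s * r ^ n < 1 / 2) sequentially"
    by (rule order_tendstoD) auto
  then obtain N where N: "\<And>n. n \<ge> N \<Longrightarrow> s * r ^ n < 1 / 2"
    by (auto simp: eventually_sequentially)
  show ?thesis
  proof (rule summable_ratio_test)
    fix n assume "N \<le> n"
    have "norm (s ^ Suc n * r ^ (Suc n choose 2)) = s * r ^ n * (s ^ n * r ^ (n choose 2))"
      using assms by (simp add: numeral_2_eq_2 power_add)
    also have "\<dots> \<le> 1 / 2 * (s ^ n * r ^ (n choose 2))"
      using N[OF \<open>N \<le> n\<close>] assms by (intro mult_right_mono) auto
    finally show "norm (s ^ Suc n * r ^ (Suc n choose 2)) \<le> 1 / 2 * norm (s ^ n * r ^ (n choose 2))"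
      using assms by simp
  qed simp
qed

section \<open>q-Pochhammer symbols\<close>

lemma norm_power_less_1:
  fixes q :: complex
  assumes "norm q < 1" "n > 0"
  shows "norm (q ^ n) < 1"
  using assms unfolding norm_power by (simp add: power_less_one_iff)

lemma convergent_prod_qpoch:
  fixes a q :: complex
  assumes "norm q < 1"
  shows "convergent_prod (\<lambda>i. 1 - a * q ^ i)"
proof -
  have "summable (\<lambda>i. norm (1 - a * q ^ i - 1))"
    using assms by (simp add: norm_mult norm_power summable_mult)
  then show ?thesis
    by (intro abs_convergent_prod_imp_convergent_prod summable_imp_abs_convergent_prod)
qed

lemma qpoch_inf_LIMSEQ:
  assumes "norm q < 1"
  shows "(\<lambda>n. \<Prod>i<n. 1 - a * q ^ i) \<longlonglongrightarrow> qpoch_inf a q"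
proof -
  from convergent_prod_LIMSEQ[OF convergent_prod_qpoch[OF assms]] show ?thesis
    unfolding qpoch_inf_def[symmetric]
    by (subst filterlim_sequentially_Suc[symmetric]) (simp add: lessThan_Suc_atMost)
qed

lemma qpoch_inf_nonzero:
  assumes "norm q < 1" "\<And>i. a * q ^ i \<noteq> 1"
  shows "qpoch_inf a q \<noteq> 0"
  unfolding qpoch_inf_def using assms
  by (intro prodinf_nonzero convergent_prod_qpoch) auto

lemma norm_mult_power_less_1:
  fixes a q :: complex
  assumes "norm q < 1" "norm a < 1"
  shows "norm (a * q ^ n) < 1"
proof -
  have "norm (a * q ^ n) \<le> norm a * 1"
    using assms unfolding norm_mult norm_power by (intro mult_left_mono power_le_one) auto
  with assms show ?thesis
    by simp
qed

lemma mult_power_neq_1: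
  fixes a q :: complex
  assumes "norm q < 1" "norm a < 1"
  shows "a * q ^ i \<noteq> 1"
  using norm_mult_power_less_1[OF assms, of i] by force

lemma qpoch_inf_nonzero':
  assumes "norm q < 1" "norm a < 1"
  shows "qpoch_inf a q \<noteq> 0"
  using assms by (intro qpoch_inf_nonzero mult_power_neq_1)

text \<open>Comparing limits of partial products, rather than dividing, covers arguments at which a
  factor vanishes.\<close>

lemma qpoch_inf_rec:
  assumes "norm q < 1"
  shows "qpoch_inf a q = (1 - a) * qpoch_inf (a * q) q"
proof (rule LIMSEQ_unique)
  show "(\<lambda>n. \<Prod>i<Suc n. 1 - a * q ^ i) \<longlonglongrightarrow> qpoch_inf a q"
    using qpoch_inf_LIMSEQ[OF assms] by (rule LIMSEQ_Suc)
  have "(\<lambda>n. (1 - a) * (\<Prod>i<n. 1 - a * q * q ^ i)) \<longlonglongrightarrow> (1 - a) * qpoch_inf (a * q) q"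
    by (intro tendsto_intros qpoch_inf_LIMSEQ assms)
  then show "(\<lambda>n. \<Prod>i<Suc n. 1 - a * q ^ i) \<longlonglongrightarrow> (1 - a) * qpoch_inf (a * q) q"
    unfolding prod.lessThan_Suc_shift by (simp add: mult.assoc)
qed

lemma qpoch_inf_split:
  assumes "norm q < 1"
  shows "qpoch_inf a q = (\<Prod>i<n. 1 - a * q ^ i) * qpoch_inf (a * q ^ n) q"
proof (induction n)
  case (Suc n)
  then show ?case
    using qpoch_inf_rec[OF assms, of "a * q ^ n"] by (simp add: mult_ac)
qed simp

lemma qpoch_inf_eq_0:
  assumes "norm q < 1" "a * q ^ n = 1"
  shows "qpoch_inf a q = 0"
  by (subst qpoch_inf_split[OF assms(1), of _ "Suc n"]) (use assms(2) in simp)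

lemma qpoch_inf_0 [simp]: "qpoch_inf 0 q = 1"
  by (simp add: qpoch_inf_def)

lemma qpoch_inf_mult_minus:
  assumes "norm q < 1"
  shows "qpoch_inf a q * qpoch_inf (- a) q = qpoch_inf (a ^ 2) (q ^ 2)"
proof (rule LIMSEQ_unique)
  show "(\<lambda>n. (\<Prod>i<n. 1 - a * q ^ i) * (\<Prod>i<n. 1 - - a * q ^ i))
          \<longlonglongrightarrow> qpoch_inf a q * qpoch_inf (- a) q"
    by (intro tendsto_intros qpoch_inf_LIMSEQ assms)
  have "norm (q ^ 2) < 1"
    using assms by (intro norm_power_less_1) auto
  then have "(\<lambda>n. \<Prod>i<n. 1 - a ^ 2 * (q ^ 2) ^ i) \<longlonglongrightarrow> qpoch_inf (a ^ 2) (q ^ 2)"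
    by (rule qpoch_inf_LIMSEQ)
  then show "(\<lambda>n. (\<Prod>i<n. 1 - a * q ^ i) * (\<Prod>i<n. 1 - - a * q ^ i))
          \<longlonglongrightarrow> qpoch_inf (a ^ 2) (q ^ 2)"
    unfolding prod.distrib[symmetric]
    by (rule Lim_transform_eventually)
       (auto intro!: always_eventually prod.cong simp: algebra_simps power2_eq_square power_mult_distrib)
qed

lemma qpoch_inf_even_odd:
  assumes "norm q < 1"
  shows "qpoch_inf a q = qpoch_inf a (q ^ 2) * qpoch_inf (a * q) (q ^ 2)"
proof (rule LIMSEQ_unique)
  have q2: "norm (q ^ 2) < 1"
    using assms by (intro norm_power_less_1) auto
  show "(\<lambda>n. \<Prod>i<2 * n. 1 - a * q ^ i) \<longlonglongrightarrow> qpoch_inf a q"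
    by (rule filterlim_compose[OF qpoch_inf_LIMSEQ[OF assms]])
       (auto intro!: filterlim_subseq strict_monoI)
  have "(\<Prod>i<2 * n. 1 - a * q ^ i)
          = (\<Prod>i<n. 1 - a * (q ^ 2) ^ i) * (\<Prod>i<n. 1 - a * q * (q ^ 2) ^ i)" for n
    by (induction n) (simp_all add: power_mult[symmetric] mult_ac)
  then show "(\<lambda>n. \<Prod>i<2 * n. 1 - a * q ^ i)
          \<longlonglongrightarrow> qpoch_inf a (q ^ 2) * qpoch_inf (a * q) (q ^ 2)"
    by (simp only:) (intro tendsto_intros qpoch_inf_LIMSEQ q2)
qed

lemma qpoch_0 [simp]:
  assumes "norm q < 1" "norm a < 1"
  shows "qpoch a q 0 = 1"
  using qpoch_inf_nonzero'[OF assms] by (simp add: qpoch_def)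

text \<open>The bound on \<open>a\<close> keeps the denominator in the definition of
  \<open>qpoch\<close> nonzero, so the common tail of the two infinite products cancels.\<close>

lemma qpoch_eq_prod:
  assumes "norm q < 1" "norm a < 1"
  shows "qpoch a q n = (\<Prod>i<n. 1 - a * q ^ i)"
proof -
  have "qpoch_inf (a * q ^ n) q \<noteq> 0"
    by (intro qpoch_inf_nonzero' norm_mult_power_less_1 assms)
  then show ?thesis
    using qpoch_inf_split[OF assms(1), of a n] by (simp add: qpoch_def field_simps)
qed

lemma qpoch_Suc:
  assumes "norm q < 1" "norm a < 1"
  shows "qpoch a q (Suc n) = qpoch a q n * (1 - a * q ^ n)"
  by (simp add: qpoch_eq_prod assms)

lemma qpoch_nonzero:
  assumes "norm q < 1" "norm a < 1"
  shows "qpoch a q n \<noteq> 0"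
  using mult_power_neq_1[OF assms] by (auto simp: qpoch_eq_prod assms)

lemma qpoch_LIMSEQ:
  assumes "norm q < 1" "norm a < 1"
  shows "(\<lambda>n. qpoch a q n) \<longlonglongrightarrow> qpoch_inf a q"
  using qpoch_inf_LIMSEQ[OF assms(1), of a] by (simp add: qpoch_eq_prod assms)

lemma qpoch_bounded:
  assumes "norm q < 1" "norm a < 1"
  obtains C where "C > 0" "\<And>n. norm (qpoch a q n) \<le> C"
  using convergentI[OF qpoch_LIMSEQ[OF assms]] that
  by (auto dest!: convergent_imp_Bseq simp: Bseq_def)

text \<open>The limit of the symbols is nonzero, so their reciprocals converge as well. These bounds
  supply the constants in the majorants below.\<close>

lemma inverse_qpoch_bounded:
  assumes "norm q < 1" "norm a < 1"
  obtains C where "C > 0" "\<And>n. norm (1 / qpoch a q n) \<le> C"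
proof -
  have "(\<lambda>n. 1 / qpoch a q n) \<longlonglongrightarrow> 1 / qpoch_inf a q"
    by (intro tendsto_intros qpoch_LIMSEQ qpoch_inf_nonzero' assms)
  from convergentI[OF this] show ?thesis
    using that by (auto dest!: convergent_imp_Bseq simp: Bseq_def)
qed

section \<open>Euler's identities\<close>

text \<open>The final step of both Euler identities: iterating a functional equation moves the
  argument to \<open>z * q ^ n\<close>, and continuity at 0 leaves the constant coefficient.\<close>

lemma powser_tendsto_0:
  fixes c :: "nat \<Rightarrow> complex"
  assumes "summable (\<lambda>n. c n * K ^ n)" "K \<noteq> 0" "norm q < 1"
  shows "(\<lambda>n. \<Sum>k. c k * (z * q ^ n) ^ k) \<longlonglongrightarrow> c 0"
proof -
  have "isCont (\<lambda>x. \<Sum>k. c k * x ^ k) 0"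
    using assms by (intro isCont_powser) auto
  moreover have "(\<lambda>n. z * q ^ n) \<longlonglongrightarrow> 0"
    using tendsto_mult_right[OF LIMSEQ_power_zero[OF assms(3)], of z] by (simp add: mult.commute)
  ultimately show ?thesis
    using isCont_tendsto_compose[of 0 "\<lambda>x. \<Sum>k. c k * x ^ k" "\<lambda>n. z * q ^ n"] by (simp add: powser_zero)
qed

lemma summable_norm_qexp:
  assumes "norm q < 1"
  shows "summable (\<lambda>n. norm (q ^ (n choose 2) / qpoch q q n * z ^ n))"
proof -
  obtain C where C: "C > 0" "\<And>n. norm (1 / qpoch q q n) \<le> C"
    using inverse_qpoch_bounded[OF assms assms] by blast
  have "summable (\<lambda>n. C * (norm z ^ n * norm q ^ (n choose 2)))"
    using assms by (intro summable_mult summable_gaussian) auto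
  then show ?thesis
  proof (rule summable_comparison_test'[where N = 0])
    fix n
    have "norm (q ^ (n choose 2) / qpoch q q n * z ^ n)
            = norm (1 / qpoch q q n) * (norm z ^ n * norm q ^ (n choose 2))"
      by (simp add: norm_mult norm_divide norm_power)
    also have "\<dots> \<le> C * (norm z ^ n * norm q ^ (n choose 2))"
      by (intro mult_right_mono C) auto
    finally show "norm (norm (q ^ (n choose 2) / qpoch q q n * z ^ n))
            \<le> C * (norm z ^ n * norm q ^ (n choose 2))"
      by simp
  qed
qed

text \<open>The recursion for the coefficients is equivalent to
  \<open>F z = (1 + z) * F (z * q)\<close>; iterating this equation splits off the factors of the
  product one by one.\<close>

theorem euler_qexp:
  assumes q: "norm q < 1"
  shows "((\<lambda>n. q ^ (n choose 2) / qpoch q q n * z ^ n) has_sum qpoch_inf (- z) q) UNIV"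
proof -
  define c where "c n = q ^ (n choose 2) / qpoch q q n" for n
  define F where "F z = (\<Sum>n. c n * z ^ n)" for z
  have summable: "summable (\<lambda>n. c n * z ^ n)" for z
    unfolding c_def by (rule summable_norm_cancel[OF summable_norm_qexp[OF q]])
  have F: "(\<lambda>n. c n * z ^ n) sums F z" for z
    unfolding F_def by (rule summable_sums[OF summable])
  have c_Suc: "c (Suc n) * (1 - q ^ Suc n) = q ^ n * c n" for n
    using qpoch_nonzero[OF q q, of "Suc n"]
    by (simp add: c_def qpoch_Suc q numeral_2_eq_2 power_add)
  have rec: "F z = (1 + z) * F (z * q)" for z
  proof -
    have d: "(\<lambda>n. c n * z ^ n - c n * (z * q) ^ n) sums (F z - F (z * q))"
      by (intro sums_diff F)
    have "(\<lambda>n. c (Suc n) * z ^ Suc n - c (Suc n) * (z * q) ^ Suc n) sums (F z - F (z * q))"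
      using d by (subst sums_Suc_iff) simp
    moreover have "c (Suc n) * z ^ Suc n - c (Suc n) * (z * q) ^ Suc n = z * (c n * (z * q) ^ n)"
      for n
    proof -
      have "c (Suc n) * z ^ Suc n - c (Suc n) * (z * q) ^ Suc n
              = z ^ Suc n * (c (Suc n) * (1 - q ^ Suc n))"
        by (simp add: algebra_simps power_mult_distrib)
      also have "\<dots> = z * (c n * (z * q) ^ n)"
        unfolding c_Suc by (simp add: algebra_simps power_mult_distrib)
      finally show ?thesis .
    qed
    ultimately have "F z - F (z * q) = z * F (z * q)"
      using sums_mult[OF F, of z "z * q"] by (metis (no_types, lifting) sums_unique2 sums_cong)
    then show ?thesis
      by (simp add: algebra_simps)
  qed
  have "F z = (\<Prod>i<n. 1 - (- z) * q ^ i) * F (z * q ^ n)" for n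
  proof (induction n)
    case (Suc n)
    then show ?case
      using rec[of "z * q ^ n"] by (simp add: mult_ac)
  qed simp
  moreover have "(\<lambda>n. (\<Prod>i<n. 1 - (- z) * q ^ i) * F (z * q ^ n)) \<longlonglongrightarrow> qpoch_inf (- z) q * c 0"
    unfolding F_def
    by (intro tendsto_mult qpoch_inf_LIMSEQ q powser_tendsto_0[of _ 1] summable) auto
  ultimately have "F z = qpoch_inf (- z) q"
    using q by (simp add: LIMSEQ_const_iff c_def numeral_2_eq_2)
  then show ?thesis
    using norm_summable_imp_has_sum[OF summable_norm_qexp[OF q]] F unfolding c_def by metis
qed

lemma summable_norm_qbinomial:
  assumes "norm q < 1" "norm z < 1"
  shows "summable (\<lambda>n. norm (1 / qpoch q q n * z ^ n))"
proof -
  obtain C where C: "C > 0" "\<And>n. norm (1 / qpoch q q n) \<le> C"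
    using inverse_qpoch_bounded[OF assms(1) assms(1)] by blast
  have "summable (\<lambda>n. C * norm z ^ n)"
    using assms by (intro summable_mult summable_geometric) auto
  then show ?thesis
  proof (rule summable_comparison_test'[where N = 0])
    fix n
    show "norm (norm (1 / qpoch q q n * z ^ n)) \<le> C * norm z ^ n"
      using mult_right_mono[OF C(2), of "norm z ^ n" n] by (simp add: norm_mult norm_divide norm_power)
  qed
qed

text \<open>The functional equation is now \<open>(1 - z) * F z = F (z * q)\<close>. The factors
  accumulate on the side of \<open>F z\<close>, which gives the reciprocal of the product.\<close>

theorem euler_qbinomial:
  assumes q: "norm q < 1" and z: "norm z < 1"
  shows "((\<lambda>n. 1 / qpoch q q n * z ^ n) has_sum 1 / qpoch_inf z q) UNIV"
proof -
  define c where "c n = 1 / qpoch q q n" for n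
  define F where "F z = (\<Sum>n. c n * z ^ n)" for z
  have summable: "summable (\<lambda>n. c n * z ^ n)" if "norm z < 1" for z
    unfolding c_def by (rule summable_norm_cancel[OF summable_norm_qbinomial[OF q that]])
  have F: "(\<lambda>n. c n * z ^ n) sums F z" if "norm z < 1" for z
    unfolding F_def by (rule summable_sums[OF summable[OF that]])
  have c_Suc: "c (Suc n) * (1 - q ^ Suc n) = c n" for n
    using qpoch_nonzero[OF q q, of "Suc n"] by (simp add: c_def qpoch_Suc q)
  have rec: "(1 - z) * F z = F (z * q)" if "norm z < 1" for z
  proof -
    have zq: "norm (z * q) < 1"
      using norm_mult_power_less_1[OF q that, of 1] by simp
    have d: "(\<lambda>n. c n * z ^ n - c n * (z * q) ^ n) sums (F z - F (z * q))"
      by (intro sums_diff F that zq)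
    have "(\<lambda>n. c (Suc n) * z ^ Suc n - c (Suc n) * (z * q) ^ Suc n) sums (F z - F (z * q))"
      using d by (subst sums_Suc_iff) simp
    moreover have "c (Suc n) * z ^ Suc n - c (Suc n) * (z * q) ^ Suc n = z * (c n * z ^ n)"
      for n
    proof -
      have "c (Suc n) * z ^ Suc n - c (Suc n) * (z * q) ^ Suc n
              = z ^ Suc n * (c (Suc n) * (1 - q ^ Suc n))"
        by (simp add: algebra_simps power_mult_distrib)
      also have "\<dots> = z * (c n * z ^ n)"
        unfolding c_Suc by (simp add: algebra_simps)
      finally show ?thesis .
    qed
    ultimately have "F z - F (z * q) = z * F z"
      using sums_mult[OF F[OF that], of z] by (metis (no_types, lifting) sums_unique2 sums_cong)
    then show ?thesis
      by (simp add: algebra_simps)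
  qed
  have "(\<Prod>i<n. 1 - z * q ^ i) * F z = F (z * q ^ n)" for n
  proof (induction n)
    case (Suc n)
    have "(\<Prod>i<Suc n. 1 - z * q ^ i) * F z = (1 - z * q ^ n) * ((\<Prod>i<n. 1 - z * q ^ i) * F z)"
      by (simp add: mult_ac)
    also have "\<dots> = (1 - z * q ^ n) * F (z * q ^ n)"
      by (simp only: Suc.IH)
    also have "\<dots> = F (z * q ^ Suc n)"
      by (subst rec[OF norm_mult_power_less_1[OF q z]]) (simp add: mult_ac)
    finally show ?case .
  qed simp
  \<comment> \<open>Convergence is known only inside the unit disc, so continuity at 0 is drawn from
    convergence at \<open>1 / 2\<close>.\<close>
  moreover have "(\<lambda>n. F (z * q ^ n)) \<longlonglongrightarrow> c 0"
    unfolding F_def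
    by (intro tendsto_mult qpoch_inf_LIMSEQ q powser_tendsto_0[of _ "1 / 2"] summable)
       (auto simp: norm_divide)
  moreover have "(\<lambda>n. (\<Prod>i<n. 1 - z * q ^ i) * F z) \<longlonglongrightarrow> qpoch_inf z q * F z"
    by (intro tendsto_intros qpoch_inf_LIMSEQ q)
  ultimately have "qpoch_inf z q * F z = 1"
    using q by (simp add: c_def LIMSEQ_unique)
  then have "F z = 1 / qpoch_inf z q"
    using qpoch_inf_nonzero'[OF q z] by (simp add: field_simps)
  then show ?thesis
    using norm_summable_imp_has_sum[OF summable_norm_qbinomial[OF q z]] F[OF z]
    unfolding c_def by metis
qed

section \<open>The Jacobi triple product\<close>

text \<open>Products of consecutive integers are even, so all divisions are exact. The cross term
  \<open>n * m\<close> is what turns a shifted theta term into a term of Euler's series.\<close>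

lemma triangular_add:
  fixes n m :: int
  shows "(n + m) * (n + m - 1) div 2 = n * (n - 1) div 2 + m * (m - 1) div 2 + n * m"
proof -
  have "even (n * (n - 1))" "even (m * (m - 1))"
    by auto
  moreover have "(n + m) * (n + m - 1) = n * (n - 1) + m * (m - 1) + 2 * (n * m)"
    by (simp add: algebra_simps)
  ultimately show ?thesis
    by (simp add: div_plus_div_distrib_dvd_left div_plus_div_distrib_dvd_right)
qed

lemma int_choose_two: "int (n choose 2) = int n * (int n - 1) div 2"
  by (cases n) (simp_all add: choose_two zdiv_int algebra_simps)

lemma summable_on_nat:
  fixes f :: "nat \<Rightarrow> real"
  assumes "summable f" "\<And>n. f n \<ge> 0"
  shows "f summable_on UNIV"
  using assms by (subst summable_on_UNIV_nonneg_real_iff) auto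

text \<open>The integers split into \<open>n\<close> and \<open>- n - 1\<close> for natural
  \<open>n\<close>; up to a constant factor, each half is a series of the kind in
  \<open>summable_gaussian\<close>.\<close>

lemma theta_summable:
  fixes q z :: complex
  assumes "norm q < 1" "q \<noteq> 0" "z \<noteq> 0"
  shows "(\<lambda>n::int. norm (z powi n * q powi (n * (n - 1) div 2))) summable_on UNIV"
    (is "?f summable_on _")
proof -
  have "(\<lambda>n. norm z ^ n * norm q ^ (n choose 2)) summable_on UNIV"
    using assms by (intro summable_on_nat summable_gaussian) auto
  moreover have "?f \<circ> int = (\<lambda>n. norm z ^ n * norm q ^ (n choose 2))"
    by (auto simp: fun_eq_iff norm_mult norm_power int_choose_two[symmetric])
  ultimately have 1: "?f summable_on range int"
    by (subst summable_on_reindex) auto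
  \<comment> \<open>This is the term at index -1. From there on the series in \<open>- n - 1\<close>
    has \<open>s = norm q * ?c\<close>.\<close>
  let ?c = "norm q / norm z"
  have "(\<lambda>n. ?c * ((norm q * ?c) ^ n * norm q ^ (n choose 2))) summable_on UNIV"
    using assms by (intro summable_on_cmult_right summable_on_nat summable_gaussian) auto
  moreover have "?f (- int n - 1) = ?c * ((norm q * ?c) ^ n * norm q ^ (n choose 2))" for n
  proof -
    have "(- int n - 1) * (- int n - 1 - 1) div 2 = int ((n choose 2) + 2 * n + 1)"
      using triangular_add[of "int n" 2] unfolding of_nat_add int_choose_two
      by (simp add: algebra_simps)
    then have "q powi ((- int n - 1) * (- int n - 1 - 1) div 2) = q ^ ((n choose 2) + 2 * n + 1)"
      by (simp only: power_int_of_nat)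
    moreover have "z powi (- int n - 1) = inverse z ^ Suc n"
      by (simp add: power_int_def nat_add_distrib)
    ultimately show ?thesis
      by (simp add: norm_mult norm_power norm_inverse power_add power_mult divide_inverse
          power2_eq_square power_mult_distrib mult_ac)
  qed
  ultimately have 2: "?f summable_on range (\<lambda>n. - int n - 1)"
    by (subst summable_on_reindex) (auto simp: inj_on_def o_def)
  have "n \<in> range int \<union> range (\<lambda>n. - int n - 1)" for n :: int
  proof (cases "n \<ge> 0")
    case True
    then show ?thesis
      using nonneg_int_cases by blast
  next
    case False
    then have "n = - int (nat (- n - 1)) - 1"
      by simp
    then show ?thesis
      by blast
  qed
  then have "UNIV = range int \<union> range (\<lambda>n. - int n - 1)"
    by blast
  then show ?thesis
    using summable_on_Un_disjoint[OF 1 2] by force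
qed

text \<open>The double family \<open>f\<close> is summed in two ways. Over \<open>m\<close>, Euler's
  series turns the row into \<open>\<theta> n\<close> times \<open>(q^(1+n);q)_inf\<close>, and the
  sum of these over \<open>n\<close> is again Euler's series, for \<open>(-z;q)_inf\<close>. Over
  \<open>n\<close>, each column is a shifted theta series times \<open>e m\<close>, and the
  \<open>e m\<close> add up to \<open>1 / (-q/z;q)_inf\<close>, which requires
  \<open>norm q < norm z\<close>.\<close>

theorem jacobi_triple_product:
  assumes q: "norm q < 1" "q \<noteq> 0" and z: "norm q < norm z"
  shows "((\<lambda>n::int. z powi n * q powi (n * (n - 1) div 2)) has_sum
           qpoch_inf q q * qpoch_inf (- z) q * qpoch_inf (- (q / z)) q) UNIV"
proof -
  define \<theta> where "\<theta> n = z powi n * q powi (n * (n - 1) div 2)" for n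
  define \<Theta> where "\<Theta> = infsum \<theta> UNIV"
  define e where "e m = 1 / qpoch q q m * (- (q / z)) ^ m" for m
  define f where "f = (\<lambda>(n, m). \<theta> n * (q ^ (m choose 2) / qpoch q q m * (- (q powi (1 + n))) ^ m))"
  have z0: "z \<noteq> 0" and qz: "norm (- (q / z)) < 1"
    using z by (auto simp: norm_divide divide_less_eq)
  have norm_\<theta>: "(\<lambda>n. norm (\<theta> n)) summable_on UNIV"
    unfolding \<theta>_def using q z0 by (intro theta_summable)
  have \<theta>: "(\<theta> has_sum \<Theta>) UNIV"
    unfolding \<Theta>_def by (rule has_sum_infsum[OF abs_summable_summable[OF norm_\<theta>]])
  have norm_e: "(\<lambda>m. norm (e m)) summable_on UNIV"
    unfolding e_def by (intro summable_on_nat summable_norm_qbinomial q qz) auto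
  have f: "f (n, m) = \<theta> (n + int m) * e m" for n m
  proof -
    have "\<theta> (n + int m) = \<theta> n * (z ^ m * q ^ (m choose 2) * q powi (n * int m))"
      using q z0 by (simp add: \<theta>_def triangular_add int_choose_two[symmetric] power_int_add)
    moreover have "(- (q powi (1 + n))) ^ m = (- q) ^ m * q powi (n * int m)"
    proof -
      have "- (q powi (1 + n)) = (- q) * q powi n"
        using q by (simp add: power_int_add)
      then show ?thesis
        by (simp only: power_mult_distrib power_int_power')
    qed
    moreover have "z ^ m * (- (q / z)) ^ m = (- q) ^ m"
      using z0 by (simp add: power_mult_distrib[symmetric])
    ultimately show ?thesis
      by (simp add: f_def e_def mult_ac)
  qed
  have "(\<lambda>(n, m). \<theta> n * e m) summable_on UNIV \<times> UNIV"
    using summable_norm_on_times[OF norm_\<theta> norm_e] abs_summable_summable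
    by (simp add: case_prod_unfold)
  \<comment> \<open>The shear \<open>(n, m)\<close> to \<open>(n + m, m)\<close> carries
    \<open>f\<close> to a product of two absolutely summable families.\<close>
  then have summable_f: "f summable_on UNIV \<times> UNIV"
    by (subst summable_on_reindex_bij_witness[of _ "\<lambda>(n, m). (n - int m, m)"
          "\<lambda>(n, m). (n + int m, m)" _ "\<lambda>(n, m). \<theta> n * e m"]) (auto simp: f)
  have "((\<lambda>n. \<theta> n * qpoch_inf (q powi (1 + n)) q) has_sum (\<Theta> * (1 / qpoch_inf (- (q / z)) q))) UNIV"
  proof (rule has_sum_swap_complex[OF summable_f])
    show "((\<lambda>m. f (n, m)) has_sum \<theta> n * qpoch_inf (q powi (1 + n)) q) UNIV" for n
      using has_sum_cmult_right[OF euler_qexp[OF q(1)], of "\<theta> n" "- (q powi (1 + n))"]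
      by (simp add: f_def)
    have "((\<lambda>n. \<theta> (n + int m)) has_sum \<Theta>) UNIV" for m
      using \<theta> by (subst has_sum_reindex_bij_witness[of _ "\<lambda>n. n - int m" "\<lambda>n. n + int m"]) auto
    then show "((\<lambda>n. f (n, m)) has_sum \<Theta> * e m) UNIV" for m
      unfolding f by (rule has_sum_cmult_left)
    show "((\<lambda>m. \<Theta> * e m) has_sum \<Theta> * (1 / qpoch_inf (- (q / z)) q)) UNIV"
      unfolding e_def by (intro has_sum_cmult_right euler_qbinomial q qz)
  qed
  moreover have "((\<lambda>n. \<theta> n * qpoch_inf (q powi (1 + n)) q) has_sum (qpoch_inf q q * qpoch_inf (- z) q)) UNIV"
  proof -
    have "\<theta> (int n) * qpoch_inf (q powi (1 + int n)) q
            = qpoch_inf q q * (q ^ (n choose 2) / qpoch q q n * z ^ n)" for n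
    proof -
      have "qpoch_inf (q * q ^ n) q \<noteq> 0"
        by (intro qpoch_inf_nonzero' norm_mult_power_less_1 q)
      then show ?thesis
        using q qpoch_inf_nonzero'[OF q(1) q(1)]
        by (simp add: \<theta>_def qpoch_def int_choose_two[symmetric] power_int_add)
    qed
    then have "((\<lambda>n. \<theta> n * qpoch_inf (q powi (1 + n)) q) has_sum (qpoch_inf q q * qpoch_inf (- z) q)) (range int)"
      using has_sum_cmult_right[OF euler_qexp[OF q(1)], of "qpoch_inf q q" z]
      by (subst has_sum_reindex) (auto simp: o_def)
    \<comment> \<open>For negative \<open>n\<close> the product contains the factor with index
      \<open>- 1 - n\<close>, which is \<open>1 - 1\<close>.\<close>
    moreover have "\<theta> n * qpoch_inf (q powi (1 + n)) q = 0" if "n \<notin> range int" for n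
    proof -
      have "n < 0"
        using that nonneg_int_cases[of n] by force
      then have "q powi (1 + n) * q ^ nat (- 1 - n) = 1"
        using q by (subst power_int_of_nat[symmetric]) (simp add: power_int_add[symmetric])
      then show ?thesis
        using qpoch_inf_eq_0[OF q(1)] by simp
    qed
    ultimately show ?thesis
      using has_sum_cong_neutral[where S = "range int" and T = UNIV
            and f = "\<lambda>n. \<theta> n * qpoch_inf (q powi (1 + n)) q"
            and g = "\<lambda>n. \<theta> n * qpoch_inf (q powi (1 + n)) q"] by auto
  qed
  ultimately have "\<Theta> * (1 / qpoch_inf (- (q / z)) q) = qpoch_inf q q * qpoch_inf (- z) q"
    by (rule has_sum_unique)
  then have "\<Theta> = qpoch_inf q q * qpoch_inf (- z) q * qpoch_inf (- (q / z)) q"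
    using qpoch_inf_nonzero'[OF q(1) qz] by (simp add: field_simps)
  with \<theta> show ?thesis
    unfolding \<theta>_def by simp
qed

section \<open>Goellnitz--Gordon series\<close>

text \<open>For \<open>M = 0\<close> and \<open>M = 1\<close> these are the two Goellnitz--Gordon series at \<open>- q\<close>.\<close>

definition gg_term :: "complex \<Rightarrow> nat \<Rightarrow> nat \<Rightarrow> complex" where
  "gg_term q M k = qpoch q (q ^ 2) k / qpoch (q ^ 2) (q ^ 2) k * (-1) ^ k * q ^ (k ^ 2 + 2 * k * M)"

definition gg_sum :: "complex \<Rightarrow> nat \<Rightarrow> complex" where
  "gg_sum q M = infsum (gg_term q M) UNIV"

lemma gg_term_has_sum:
  assumes q: "norm q < 1"
  shows "(gg_term q M has_sum gg_sum q M) UNIV"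
proof -
  have p: "norm (q ^ 2) < 1"
    using q by (intro norm_power_less_1) auto
  obtain C where C: "C > 0" "\<And>k. norm (qpoch q (q ^ 2) k) \<le> C"
    using qpoch_bounded[OF p q] by blast
  obtain D where D: "D > 0" "\<And>k. norm (1 / qpoch (q ^ 2) (q ^ 2) k) \<le> D"
    using inverse_qpoch_bounded[OF p p] by blast
  have "(\<lambda>k. C * D * norm q ^ k) summable_on UNIV"
    using q C D by (intro summable_on_cmult_right summable_on_nat summable_geometric) auto
  then have "(\<lambda>k. norm (gg_term q M k)) summable_on UNIV"
  proof (rule summable_on_comparison_test)
    fix k
    have "norm (gg_term q M k)
            = norm (qpoch q (q ^ 2) k) * norm (1 / qpoch (q ^ 2) (q ^ 2) k) * norm q ^ (k ^ 2 + 2 * k * M)"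
      by (simp add: gg_term_def norm_mult norm_divide norm_power)
    also have "\<dots> \<le> C * D * norm q ^ k"
    proof (intro mult_mono C D power_decreasing)
      show "k \<le> k ^ 2 + 2 * k * M"
        by (simp add: power2_eq_square trans_le_add1)
    qed (use q C D in auto)
    finally show "norm (gg_term q M k) \<le> C * D * norm q ^ k" .
  qed auto
  then show ?thesis
    unfolding gg_sum_def by (intro has_sum_infsum) (rule abs_summable_summable)
qed

text \<open>By telescoping \<open>(1 - q ^ (2 * k)) * gg_term q M k\<close> over \<open>k\<close>.\<close>

lemma gg_sum_rec:
  assumes q: "norm q < 1"
  shows "gg_sum q M = (1 - q ^ (2 * M + 1)) * gg_sum q (M + 1) + q ^ (2 * M + 2) * gg_sum q (M + 2)"
proof -
  have p: "norm (q ^ 2) < 1"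
    using q by (intro norm_power_less_1) auto
  have sums: "gg_term q N sums gg_sum q N" for N
    using gg_term_has_sum[OF q] by (rule has_sum_imp_sums)
  have shift: "gg_term q (N + 1) k = q ^ (2 * k) * gg_term q N k" for N k
    by (simp add: gg_term_def power_add algebra_simps)
  have "(\<lambda>k. gg_term q M k - gg_term q (M + 1) k) sums (gg_sum q M - gg_sum q (M + 1))"
    by (intro sums_diff sums)
  \<comment> \<open>The terms at \<open>k = 0\<close> do not depend on \<open>M\<close>, so dropping
    them leaves the sum of differences unchanged.\<close>
  then have "(\<lambda>k. gg_term q M (Suc k) - gg_term q (M + 1) (Suc k)) sums (gg_sum q M - gg_sum q (M + 1))"
    by (subst sums_Suc_iff) (simp add: gg_term_def)
  \<comment> \<open>The difference is \<open>gg_term q M (Suc k)\<close> times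
    \<open>1 - q ^ (2 * Suc k)\<close>, and this factor cancels the last one of the
    denominator.\<close>
  moreover have "gg_term q M (Suc k) - gg_term q (M + 1) (Suc k)
      = - (q ^ (2 * M + 1)) * (gg_term q (M + 1) k - q * gg_term q (M + 2) k)" for k
  proof -
    have "gg_term q M (Suc k) * (1 - q ^ (2 * Suc k))
            = - (q ^ (2 * M + 1)) * (gg_term q (M + 1) k * (1 - q ^ (2 * k + 1)))"
    proof -
      have "q ^ 2 * (q ^ 2) ^ k \<noteq> 1"
        by (rule mult_power_neq_1[OF p p])
      then have "1 - q ^ (2 * Suc k) \<noteq> 0"
        unfolding power_mult power_Suc by simp
      moreover have "q ^ ((Suc k) ^ 2 + 2 * Suc k * M) = q ^ (2 * M + 1) * q ^ (k ^ 2 + 2 * k * (M + 1))"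
        unfolding power_add[symmetric] by (rule arg_cong[where f = "power q"])
          (simp add: power2_eq_square algebra_simps)
      moreover have "qpoch (q ^ 2) (q ^ 2) (Suc k) = qpoch (q ^ 2) (q ^ 2) k * (1 - q ^ (2 * Suc k))"
        "qpoch q (q ^ 2) (Suc k) = qpoch q (q ^ 2) k * (1 - q ^ (2 * k + 1))"
        by (simp_all add: qpoch_Suc[OF p] q p power_mult) (simp add: power2_eq_square)
      ultimately show ?thesis
        by (simp add: gg_term_def del: power_Suc mult_Suc_right) (auto simp: power2_eq_square)
    qed
    then show ?thesis
      using shift[of M "Suc k"] shift[of "M + 1" k]
      by (simp add: algebra_simps)
  qed
  moreover have "(\<lambda>k. - (q ^ (2 * M + 1)) * (gg_term q (M + 1) k - q * gg_term q (M + 2) k))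
      sums (- (q ^ (2 * M + 1)) * (gg_sum q (M + 1) - q * gg_sum q (M + 2)))"
    by (intro sums_mult sums_diff sums)
  ultimately have "gg_sum q M - gg_sum q (M + 1)
      = - (q ^ (2 * M + 1)) * (gg_sum q (M + 1) - q * gg_sum q (M + 2))"
    by (simp add: sums_unique2)
  then show ?thesis
    by (simp add: algebra_simps power_add power2_eq_square)
qed

section \<open>Collapse of the finite sums over \<open>j + l = J\<close>\<close>

text \<open>
  Summing the triple series over \<open>k\<close> leaves
  \<open>mix_coeff q i l * gg_sum q (i + l)\<close>, where \<open>i = 2 * j\<close> or \<open>i = 1 + 2 * j\<close>.
\<close>

definition mix_coeff :: "complex \<Rightarrow> nat \<Rightarrow> nat \<Rightarrow> complex" where
  "mix_coeff q i l = q ^ (2 * (i + l choose 2) + 2 * (l choose 2))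
     / (qpoch q q i * qpoch (q ^ 2) (q ^ 2) l)"

text \<open>This matches the interior terms in \<open>mix_sum_rec\<close>. In terms of
  \<open>A = q ^ i\<close> and \<open>B = q ^ l\<close> and over the common denominator
  \<open>D\<close>, it becomes a polynomial identity.\<close>

lemma mix_coeff_rec:
  assumes q: "norm q < 1"
  shows "(1 - q ^ (i + 2 * l + 4)) * (1 - q ^ (i + 2 * l + 3)) * mix_coeff q (i + 2) (l + 1)
     = q ^ (2 * (i + 2 * l + 2)) * ((1 - q ^ (2 * (i + l + 2) + 1)) * mix_coeff q (i + 2) l
         + q ^ (2 * (i + l + 1) + 2) * mix_coeff q i (l + 1))"
proof -
  have p: "norm (q ^ 2) < 1"
    using q by (intro norm_power_less_1) auto
  define A B where "A = q ^ i" and "B = q ^ l"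
  define X where "X = q ^ (2 * (i + l choose 2) + 2 * (l choose 2))"
  define Y where "Y = qpoch q q i * qpoch (q ^ 2) (q ^ 2) l"
  have nz: "1 - q * A \<noteq> 0" "1 - q ^ 2 * A \<noteq> 0" "1 - q ^ 2 * B ^ 2 \<noteq> 0" "Y \<noteq> 0"
    using mult_power_neq_1[OF q q, of i] mult_power_neq_1[OF q q, of "Suc i"]
      mult_power_neq_1[OF p p, of l] qpoch_nonzero[OF q q, of i] qpoch_nonzero[OF p p, of l]
    by (auto simp: A_def B_def Y_def power2_eq_square power_mult_distrib mult_ac)
  have X: "q ^ (2 * (i + 2 + (l + 1) choose 2) + 2 * (l + 1 choose 2)) = X * q ^ 6 * A ^ 6 * B ^ 8"
    "q ^ (2 * (i + 2 + l choose 2) + 2 * (l choose 2)) = X * q ^ 2 * A ^ 4 * B ^ 4"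
    "q ^ (2 * (i + (l + 1) choose 2) + 2 * (l + 1 choose 2)) = X * A ^ 2 * B ^ 4"
    by (simp_all add: X_def A_def B_def numeral_eq_Suc power_add power_mult_distrib mult_ac
        power_mult[symmetric])
  have Y: "qpoch q q (i + 2) = qpoch q q i * (1 - q * A) * (1 - q ^ 2 * A)"
    "qpoch (q ^ 2) (q ^ 2) (l + 1) = qpoch (q ^ 2) (q ^ 2) l * (1 - q ^ 2 * B ^ 2)"
    using qpoch_Suc[OF q q, of i] qpoch_Suc[OF q q, of "Suc i"] qpoch_Suc[OF p p, of l]
    by (simp_all add: A_def B_def power_mult[symmetric] mult_ac) (simp add: power2_eq_square mult_ac)
  have 1: "mix_coeff q (i + 2) (l + 1)
      = X * q ^ 6 * A ^ 6 * B ^ 8 / (Y * (1 - q * A) * (1 - q ^ 2 * A) * (1 - q ^ 2 * B ^ 2))"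
    unfolding mix_coeff_def X Y Y_def by (simp add: mult_ac)
  have 2: "mix_coeff q (i + 2) l = X * q ^ 2 * A ^ 4 * B ^ 4 / (Y * (1 - q * A) * (1 - q ^ 2 * A))"
    unfolding mix_coeff_def X Y Y_def by (simp add: mult_ac)
  have 3: "mix_coeff q i (l + 1) = X * A ^ 2 * B ^ 4 / (Y * (1 - q ^ 2 * B ^ 2))"
    unfolding mix_coeff_def X Y Y_def by (simp add: mult_ac)
  have 4: "q ^ (i + 2 * l + 4) = q ^ 4 * A * B ^ 2" "q ^ (i + 2 * l + 3) = q ^ 3 * A * B ^ 2"
    "q ^ (2 * (i + 2 * l + 2)) = q ^ 4 * A ^ 2 * B ^ 4"
    "q ^ (2 * (i + l + 2) + 1) = q ^ 5 * A ^ 2 * B ^ 2"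
    "q ^ (2 * (i + l + 1) + 2) = q ^ 4 * A ^ 2 * B ^ 2"
    by (simp_all add: A_def B_def numeral_eq_Suc power_add power_mult_distrib mult_ac
        power_mult[symmetric])
  define D where "D = Y * (1 - q * A) * (1 - q ^ 2 * A) * (1 - q ^ 2 * B ^ 2)"
  have 2: "mix_coeff q (i + 2) l = X * q ^ 2 * A ^ 4 * B ^ 4 * (1 - q ^ 2 * B ^ 2) / D"
    unfolding 2 D_def using nz by simp
  have 3: "mix_coeff q i (l + 1) = X * A ^ 2 * B ^ 4 * ((1 - q * A) * (1 - q ^ 2 * A)) / D"
    unfolding 3 D_def using nz by simp
  have "(1 - q ^ 4 * A * B ^ 2) * (1 - q ^ 3 * A * B ^ 2) * (X * q ^ 6 * A ^ 6 * B ^ 8)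
      = q ^ 4 * A ^ 2 * B ^ 4
        * ((1 - q ^ 5 * A ^ 2 * B ^ 2) * (X * q ^ 2 * A ^ 4 * B ^ 4 * (1 - q ^ 2 * B ^ 2))
           + q ^ 4 * A ^ 2 * B ^ 2 * (X * A ^ 2 * B ^ 4 * ((1 - q * A) * (1 - q ^ 2 * A))))"
    by algebra
  then show ?thesis
    unfolding 1 2 3 4 D_def[symmetric]
    by (simp only: times_divide_eq_right add_divide_distrib[symmetric])
qed

text \<open>The relation for the top index of \<open>mix_sum_rec\<close>, where only one
  neighbouring coefficient is present.\<close>

lemma mix_coeff_Suc:
  assumes q: "norm q < 1"
  shows "mix_coeff q i (Suc l) * (1 - q ^ (2 * l + 2)) = q ^ (2 * (i + 2 * l)) * mix_coeff q i l"
proof -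
  have p: "norm (q ^ 2) < 1"
    using q by (intro norm_power_less_1) auto
  have e: "(q ^ 2) * (q ^ 2) ^ l = q ^ (2 * l + 2)"
    by (simp add: power_mult power2_eq_square)
  have "1 - q ^ (2 * l + 2) \<noteq> 0"
    using mult_power_neq_1[OF p p, of l] unfolding e by simp
  moreover have "qpoch (q ^ 2) (q ^ 2) (Suc l) = qpoch (q ^ 2) (q ^ 2) l * (1 - q ^ (2 * l + 2))"
    unfolding qpoch_Suc[OF p p] e ..
  moreover have "q ^ (2 * (i + Suc l choose 2) + 2 * (Suc l choose 2))
      = q ^ (2 * (i + 2 * l)) * q ^ (2 * (i + l choose 2) + 2 * (l choose 2))"
    unfolding power_add[symmetric] by (rule arg_cong[where f = "power q"]) (simp add: numeral_2_eq_2)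
  ultimately show ?thesis
    unfolding mix_coeff_def by (simp del: power_Suc)
qed

text \<open>The terms of the triple series with \<open>j + l = J\<close> after summation over
  \<open>k\<close>, without the power of \<open>q\<close> that depends on \<open>J\<close> alone.
  The relevant values of \<open>e\<close> are 0 and 1, the parity of the index.\<close>

definition mix_sum :: "complex \<Rightarrow> nat \<Rightarrow> nat \<Rightarrow> complex" where
  "mix_sum q e J = (\<Sum>l\<le>J. mix_coeff q (e + 2 * (J - l)) l * gg_sum q (e + 2 * (J - l) + l))"

lemma mix_sum_rec:
  assumes q: "norm q < 1" and e: "e < 2"
  shows "(1 - q ^ (e + 2 * J + 2)) * (1 - q ^ (e + 2 * J + 1)) * mix_sum q e (Suc J)
           = q ^ (2 * (e + 2 * J)) * mix_sum q e J"
proof -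
  define K where "K = (1 - q ^ (e + 2 * J + 2)) * (1 - q ^ (e + 2 * J + 1))"
  define R where "R = q ^ (2 * (e + 2 * J))"
  define c where "c l = mix_coeff q (e + 2 * (J - l)) l" for l
  define M where "M l = e + 2 * (J - l) + l" for l
  \<comment> \<open>\<open>gg_sum_rec\<close> splits each term of \<open>R * mix_sum q e J\<close>
    in two. The piece with \<open>gg_sum q (M l + 2)\<close> is \<open>v l\<close> and belongs to
    term \<open>l\<close> of \<open>mix_sum q e (Suc J)\<close>; the piece with
    \<open>gg_sum q (M l + 1)\<close> belongs to term \<open>Suc l\<close>, hence the shift in
    \<open>u\<close>. At the ends, \<open>u 0\<close> and \<open>v (Suc J)\<close> are 0.\<close>
  define u where "u l = (case l of 0 \<Rightarrow> 0
      | Suc l \<Rightarrow> R * ((1 - q ^ (2 * M l + 1)) * c l * gg_sum q (M l + 1)))" for l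
  define v where "v l = (if l \<le> J then R * (q ^ (2 * M l + 2) * c l * gg_sum q (M l + 2)) else 0)" for l
  have step: "K * (mix_coeff q (e + 2 * (Suc J - l)) l * gg_sum q (e + 2 * (Suc J - l) + l)) = u l + v l"
    if "l \<le> Suc J" for l
  proof (cases l)
    case 0
    have p: "norm (q ^ 2) < 1"
      using q by (intro norm_power_less_1) auto
    have "K * mix_coeff q (e + 2 * J + 2) 0 = R * (q ^ (2 * (e + 2 * J) + 2) * mix_coeff q (e + 2 * J) 0)"
    proof -
      have "qpoch q q (e + 2 * J + 2) = qpoch q q (e + 2 * J) * K"
        using qpoch_Suc[OF q q, of "e + 2 * J"] qpoch_Suc[OF q q, of "Suc (e + 2 * J)"]
        by (simp add: K_def mult_ac)
      moreover have "K \<noteq> 0"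
        using mult_power_neq_1[OF q q, of "e + 2 * J"] mult_power_neq_1[OF q q, of "Suc (e + 2 * J)"]
        by (auto simp: K_def)
      moreover have "q ^ (2 * (e + 2 * J + 2 choose 2)) = R * q ^ (2 * (e + 2 * J) + 2) * q ^ (2 * (e + 2 * J choose 2))"
        unfolding R_def power_add[symmetric]
        by (rule arg_cong[where f = "power q"]) (simp add: numeral_2_eq_2)
      ultimately show ?thesis
        by (simp add: mix_coeff_def binomial_eq_0 p mult_ac)
    qed
    then show ?thesis
      by (simp add: 0 u_def v_def c_def M_def mult_ac)
  next
    case (Suc a)
    show ?thesis
    proof (cases "Suc a \<le> J")
      case True
      \<comment> \<open>Writing \<open>J\<close> as a sum removes the truncated
        subtractions.\<close>
      then obtain b where J: "J = Suc a + b"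
        using le_Suc_ex by blast
      have K: "K = (1 - q ^ (e + 2 * b + 2 * a + 4)) * (1 - q ^ (e + 2 * b + 2 * a + 3))"
        unfolding K_def J
        by (intro arg_cong2[where f = "(*)"] arg_cong[where f = "\<lambda>n. 1 - q ^ n"]) auto
      have R: "R = q ^ (2 * (e + 2 * b + 2 * a + 2))"
        unfolding R_def J by (rule arg_cong[where f = "power q"]) auto
      have M: "M a = e + 2 * b + a + 2" "M (Suc a) = e + 2 * b + a + 1"
        and c: "c a = mix_coeff q (e + 2 * b + 2) a" "c (Suc a) = mix_coeff q (e + 2 * b) (a + 1)"
        by (simp_all add: M_def c_def J)
      have "K * mix_coeff q (e + 2 * b + 2) (a + 1)
          = R * ((1 - q ^ (2 * M a + 1)) * c a + q ^ (2 * M (Suc a) + 2) * c (Suc a))"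
        unfolding K R M c by (rule mix_coeff_rec[OF q])
      moreover have "e + 2 * (Suc J - l) = e + 2 * b + 2" "e + 2 * b + 2 + l = M a + 1"
        "l = a + 1" "M (Suc a) + 2 = M a + 1"
        by (simp_all add: Suc J M)
      ultimately have "K * (mix_coeff q (e + 2 * (Suc J - l)) l * gg_sum q (e + 2 * (Suc J - l) + l))
          = R * ((1 - q ^ (2 * M a + 1)) * c a + q ^ (2 * M (Suc a) + 2) * c (Suc a)) * gg_sum q (M a + 1)"
        by (simp only: mult.assoc[symmetric])
      also have "\<dots> = u l + v l"
        using True \<open>M (Suc a) + 2 = M a + 1\<close>
        by (simp only: Suc u_def v_def if_True nat.case distrib_left distrib_right mult.assoc)
      finally show ?thesis .
    next
      case False
      with that Suc have a: "a = J"
        by simp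
      have "K * mix_coeff q e (Suc J) = R * ((1 - q ^ (2 * (e + J) + 1)) * mix_coeff q e J)"
      proof -
        \<comment> \<open>Here \<open>e < 2\<close> enters: of the two consecutive exponents in
          \<open>K\<close>, the odd one is \<open>2 * (e + J) + 1\<close> and the even one is
          \<open>2 * J + 2\<close>.\<close>
        have "K = (1 - q ^ (2 * (e + J) + 1)) * (1 - q ^ (2 * J + 2))"
          using e by (cases e) (auto simp: K_def mult_ac less_Suc_eq numeral_2_eq_2)
        then show ?thesis
          using mix_coeff_Suc[OF q, of e J] by (simp add: R_def mult_ac)
      qed
      then show ?thesis
        by (simp add: Suc a u_def v_def M_def c_def mult_ac)
    qed
  qed
  have "K * mix_sum q e (Suc J) = (\<Sum>l\<le>Suc J. u l + v l)"
    unfolding mix_sum_def sum_distrib_left by (intro sum.cong refl step) auto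
  also have "\<dots> = (\<Sum>l\<le>J. u (Suc l)) + (\<Sum>l\<le>J. v l)"
    unfolding sum.distrib by (subst (1) sum.atMost_Suc_shift) (simp add: u_def v_def)
  also have "\<dots> = R * mix_sum q e J"
    unfolding mix_sum_def sum.distrib[symmetric] sum_distrib_left
  proof (intro sum.cong refl)
    fix l assume "l \<in> {..J}"
    then show "u (Suc l) + v l = R * (mix_coeff q (e + 2 * (J - l)) l * gg_sum q (e + 2 * (J - l) + l))"
      using gg_sum_rec[OF q, of "M l"]
      by (simp add: u_def v_def c_def M_def[symmetric]) (simp add: algebra_simps)
  qed
  finally show ?thesis
    by (simp only: K_def R_def)
qed

text \<open>Iterating \<open>mix_sum_rec\<close> collects the exponents
  \<open>2 * (e + 2 * i)\<close> for \<open>i < J\<close> in the numerator and extends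
  \<open>(q;q)_e\<close> to the full denominator.\<close>

lemma mix_sum_eq:
  assumes q: "norm q < 1" and e: "e < 2"
  shows "mix_sum q e J = q ^ (4 * (J choose 2) + 2 * e * J) * gg_sum q e / qpoch q q (e + 2 * J)"
proof (induction J)
  case 0
  have p: "norm (q ^ 2) < 1"
    using q by (intro norm_power_less_1) auto
  have "e choose 2 = 0"
    using e by (simp add: binomial_eq_0)
  then show ?case
    using p by (simp add: mix_sum_def mix_coeff_def binomial_eq_0)
next
  case (Suc J)
  define K where "K = (1 - q ^ (e + 2 * J + 2)) * (1 - q ^ (e + 2 * J + 1))"
  have K: "K \<noteq> 0"
    using mult_power_neq_1[OF q q, of "e + 2 * J"] mult_power_neq_1[OF q q, of "Suc (e + 2 * J)"]
    by (auto simp: K_def)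
  have Q: "qpoch q q (e + 2 * Suc J) = qpoch q q (e + 2 * J) * K"
    using qpoch_Suc[OF q q, of "e + 2 * J"] qpoch_Suc[OF q q, of "Suc (e + 2 * J)"]
    by (simp add: K_def mult_ac)
  have "K * mix_sum q e (Suc J) = q ^ (2 * (e + 2 * J)) * mix_sum q e J"
    unfolding K_def by (rule mix_sum_rec[OF q e])
  then have mix: "mix_sum q e (Suc J) = q ^ (2 * (e + 2 * J)) * mix_sum q e J / K"
    by (metis K nonzero_mult_div_cancel_left)
  have E: "q ^ (4 * (Suc J choose 2) + 2 * e * Suc J)
      = q ^ (2 * (e + 2 * J)) * q ^ (4 * (J choose 2) + 2 * e * J)"
  proof -
    have "Suc J choose 2 = J + (J choose 2)"
      by (simp add: numeral_2_eq_2)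
    then have "4 * (Suc J choose 2) + 2 * e * Suc J
        = 2 * (e + 2 * J) + (4 * (J choose 2) + 2 * e * J)"
      by (simp add: algebra_simps)
    then show ?thesis
      by (simp only: power_add)
  qed
  show ?case
    by (subst mix, subst E, subst Q, subst Suc.IH) (simp only: times_divide_eq_right divide_divide_eq_left mult.assoc)
qed

section \<open>Product evaluation of the two Goellnitz--Gordon series\<close>

text \<open>The left side sorts the factors \<open>1 - q ^ i\<close> by the parity of
  \<open>i\<close>. It makes the series in \<open>has_sum_gg_sum_eq\<close> recognizable as half of
  a series over all indices.\<close>

lemma qpoch_even_odd:
  assumes q: "norm q < 1" and e: "e < 2"
  shows "qpoch (q ^ 2) (q ^ 2) r * qpoch q (q ^ 2) (e + r) = qpoch q q (e + 2 * r)"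
proof (induction r)
  case 0
  have p: "norm (q ^ 2) < 1"
    using q by (intro norm_power_less_1) auto
  have "e = 0 \<or> e = 1"
    using e by auto
  then show ?case
    using qpoch_Suc[OF q q, of 0] qpoch_Suc[OF p q, of 0] q p by auto
next
  case (Suc r)
  have p: "norm (q ^ 2) < 1"
    using q by (intro norm_power_less_1) auto
  have "qpoch (q ^ 2) (q ^ 2) (Suc r) * qpoch q (q ^ 2) (e + Suc r)
      = qpoch q q (e + 2 * r) * ((1 - q ^ 2 * (q ^ 2) ^ r) * (1 - q * (q ^ 2) ^ (e + r)))"
    unfolding Suc.IH[symmetric] add_Suc_right qpoch_Suc[OF p p] qpoch_Suc[OF p q]
    by (simp only: mult_ac)
  also have "(1 - q ^ 2 * (q ^ 2) ^ r) * (1 - q * (q ^ 2) ^ (e + r))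
      = (1 - q * q ^ (e + 2 * r)) * (1 - q * q ^ Suc (e + 2 * r))"
  proof -
    have "e = 0 \<or> e = 1"
      using e by auto
    then show ?thesis
      by (auto simp: power_mult power2_eq_square power_mult_distrib mult_ac)
  qed
  also have "qpoch q q (e + 2 * r) * \<dots> = qpoch q q (e + 2 * Suc r)"
    using qpoch_Suc[OF q q, of "e + 2 * r"] qpoch_Suc[OF q q, of "Suc (e + 2 * r)"]
    by (simp add: mult.assoc)
  finally show ?case .
qed

text \<open>
  Expand \<open>qpoch q (q ^ 2) k\<close> by the q-binomial theorem and interchange the summations;
  the sum over \<open>k\<close> is then Euler's product.
\<close>

lemma has_sum_gg_sum_eq:
  assumes q: "norm q < 1"
    and h: "((\<lambda>r. q ^ r / (qpoch (q ^ 2) (q ^ 2) r * qpoch q (q ^ 2) (M + r))) has_sum S) UNIV"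
  shows "gg_sum q M = qpoch_inf q (q ^ 2) ^ 2 * S"
proof -
  have p: "norm (q ^ 2) < 1"
    using q by (intro norm_power_less_1) auto
  define P where "P = qpoch_inf q (q ^ 2)"
  have P: "P \<noteq> 0"
    unfolding P_def by (rule qpoch_inf_nonzero'[OF p q])
  define f where "f = (\<lambda>(k, r). (-1) ^ k * q ^ (k ^ 2 + 2 * k * M) / qpoch (q ^ 2) (q ^ 2) k
      * (1 / qpoch (q ^ 2) (q ^ 2) r * (q * (q ^ 2) ^ k) ^ r))"
  \<comment> \<open>Since \<open>k ^ 2 = 2 * (k choose 2) + k\<close>, the powers regroup into a
    term of Euler's series in \<open>k\<close> for base \<open>q ^ 2\<close>.\<close>
  have f: "f (k, r) = q ^ r / qpoch (q ^ 2) (q ^ 2) r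
      * ((q ^ 2) ^ (k choose 2) / qpoch (q ^ 2) (q ^ 2) k * (- (q * (q ^ 2) ^ (M + r))) ^ k)" for k r
  proof -
    have "k ^ 2 = 2 * (k choose 2) + k"
      by (simp add: choose_two power2_eq_square algebra_simps)
    then have "k ^ 2 + 2 * k * M + (r + 2 * k * r) = r + 2 * (k choose 2) + (k + 2 * (M + r) * k)"
      by (simp add: algebra_simps)
    then have "q ^ (k ^ 2 + 2 * k * M) * (q * (q ^ 2) ^ k) ^ r
        = q ^ r * (q ^ 2) ^ (k choose 2) * (q * (q ^ 2) ^ (M + r)) ^ k"
      by (simp only: power_mult_distrib power_mult[symmetric] power_add[symmetric])
    then show ?thesis
      by (simp add: f_def power_minus[of "q * (q ^ 2) ^ (M + r)"] mult_ac)
  qed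
  obtain D where D: "D > 0" "\<And>k. norm (1 / qpoch (q ^ 2) (q ^ 2) k) \<le> D"
    using inverse_qpoch_bounded[OF p p] by blast
  have "(\<lambda>k. norm (D * norm q ^ k)) summable_on UNIV"
    using q D by (intro summable_on_nat) (auto intro!: summable_mult summable_geometric)
  then have "(\<lambda>(k, r). norm (complex_of_real (D * norm q ^ k) * complex_of_real (D * norm q ^ r)))
      summable_on UNIV \<times> UNIV"
    by (intro summable_norm_on_times) (simp_all add: norm_mult norm_power abs_mult)
  then have "(\<lambda>z. norm (f z)) summable_on UNIV \<times> UNIV"
  proof (rule summable_on_comparison_test)
    fix z :: "nat \<times> nat"
    obtain k r where z: "z = (k, r)"
      by fastforce
    have "norm (f z) = norm (1 / qpoch (q ^ 2) (q ^ 2) k) * norm q ^ (k ^ 2 + 2 * k * M)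
        * (norm (1 / qpoch (q ^ 2) (q ^ 2) r) * norm q ^ (r + 2 * k * r))"
      by (simp add: z f_def norm_mult norm_divide norm_power power_mult_distrib power_add power_mult)
    also have "\<dots> \<le> D * norm q ^ k * (D * norm q ^ r)"
    proof (intro mult_mono D power_decreasing)
      show "k \<le> k ^ 2 + 2 * k * M"
        by (simp add: power2_eq_square trans_le_add1)
    qed (use q D in auto)
    finally show "norm (f z) \<le> (case z of (k, r) \<Rightarrow>
        norm (complex_of_real (D * norm q ^ k) * complex_of_real (D * norm q ^ r)))"
      using D by (simp add: z norm_mult norm_power)
  qed auto
  then have "f summable_on UNIV \<times> UNIV"
    by (rule abs_summable_summable)
  then have "((\<lambda>k. gg_term q M k / P) has_sum P * S) UNIV"
  proof (rule has_sum_swap_complex)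
    fix k :: nat
    have n: "norm (q * (q ^ 2) ^ k) < 1"
      by (rule norm_mult_power_less_1[OF p q])
    \<comment> \<open>Division by \<open>P\<close> turns the finite symbol in the numerator into the
      reciprocal of an infinite product, which the q-binomial series expands in powers indexed by
      \<open>r\<close>.\<close>
    have "gg_term q M k / P = (-1) ^ k * q ^ (k ^ 2 + 2 * k * M) / qpoch (q ^ 2) (q ^ 2) k
        * (1 / qpoch_inf (q * (q ^ 2) ^ k) (q ^ 2))"
      using P unfolding gg_term_def qpoch_def[of q] P_def[symmetric] by (simp add: mult_ac)
    then show "((\<lambda>r. f (k, r)) has_sum gg_term q M k / P) UNIV"
      unfolding f_def prod.case by (simp only:) (intro has_sum_cmult_right euler_qbinomial p n)
  next
    fix r :: nat
    show "((\<lambda>k. f (k, r)) has_sum (q ^ r / qpoch (q ^ 2) (q ^ 2) r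
        * qpoch_inf (- (- (q * (q ^ 2) ^ (M + r)))) (q ^ 2))) UNIV"
      unfolding f by (intro has_sum_cmult_right euler_qexp p)
  next
    \<comment> \<open>Rewriting the tail product through the finite symbol yields a second factor
      \<open>P\<close>, hence the square in the result.\<close>
    have "q ^ r / qpoch (q ^ 2) (q ^ 2) r * qpoch_inf (- (- (q * (q ^ 2) ^ (M + r)))) (q ^ 2)
        = P * (q ^ r / (qpoch (q ^ 2) (q ^ 2) r * qpoch q (q ^ 2) (M + r)))" for r
      using P unfolding qpoch_def[of q] P_def[symmetric] by simp
    then show "((\<lambda>r. q ^ r / qpoch (q ^ 2) (q ^ 2) r
        * qpoch_inf (- (- (q * (q ^ 2) ^ (M + r)))) (q ^ 2)) has_sum P * S) UNIV"
      by (simp only:) (intro has_sum_cmult_right h)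
  qed
  moreover have "((\<lambda>k. gg_term q M k / P) has_sum gg_sum q M / P) UNIV"
    by (intro has_sum_divide_const gg_term_has_sum q)
  ultimately have "P * S = gg_sum q M / P"
    by (rule has_sum_unique)
  then show ?thesis
    using P unfolding P_def[symmetric] by (simp add: field_simps power2_eq_square)
qed

text \<open>With \<open>x ^ 2 = q\<close>, the series in \<open>has_sum_gg_sum_eq\<close> is the
  even part, or the odd part divided by \<open>x\<close>, of the expansion of
  \<open>1 / (x;q)_inf\<close>. As \<open>P = A * B\<close>, the factor \<open>P ^ 2\<close> clears
  the denominators \<open>A\<close> and \<open>B\<close>.\<close>

lemma gg_sum_eq:
  assumes q: "norm q < 1" "q \<noteq> 0" and x: "x ^ 2 = q"
  shows "gg_sum q 0 = qpoch_inf q (q ^ 2) * ((qpoch_inf (- x) q + qpoch_inf x q) / 2)"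
    and "x * gg_sum q 1 = qpoch_inf q (q ^ 2) * ((qpoch_inf (- x) q - qpoch_inf x q) / 2)"
proof -
  have p: "norm (q ^ 2) < 1"
    using q by (intro norm_power_less_1) auto
  have "norm x ^ 2 < 1"
    using q x by (metis norm_power)
  then have nx: "norm x < 1" "norm (- x) < 1"
    by (simp_all add: power_less_one_iff)
  have x0: "x \<noteq> 0"
    using q x by auto
  define P where "P = qpoch_inf q (q ^ 2)"
  define A B where "A = qpoch_inf x q" and "B = qpoch_inf (- x) q"
  have AB: "P = A * B" "A \<noteq> 0" "B \<noteq> 0"
    using qpoch_inf_mult_minus[OF q(1), of x] qpoch_inf_nonzero'[OF q(1)] nx
    by (auto simp: A_def B_def P_def x)
  have euler: "((\<lambda>n. 1 / qpoch q q n * x ^ n) has_sum 1 / A) UNIV"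
    "((\<lambda>n. 1 / qpoch q q n * (- x) ^ n) has_sum 1 / B) UNIV"
    unfolding A_def B_def by (intro euler_qbinomial q nx)+
  have alt: "(\<lambda>n. 1 / qpoch q q n * (- x) ^ n)
      = (\<lambda>n. if even n then 1 / qpoch q q n * x ^ n else - (1 / qpoch q q n * x ^ n))"
    by (auto simp: fun_eq_iff)
  have "((\<lambda>r. q ^ r / (qpoch (q ^ 2) (q ^ 2) r * qpoch q (q ^ 2) (0 + r))) has_sum (1 / A + 1 / B) / 2) UNIV"
    using has_sum_even_odd(1)[OF euler(1) euler(2)[unfolded alt]] qpoch_even_odd[OF q(1), of 0]
    by (simp add: power_mult x)
  then have "gg_sum q 0 = P ^ 2 * ((1 / A + 1 / B) / 2)"
    unfolding P_def by (rule has_sum_gg_sum_eq[OF q(1)])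
  also have "\<dots> = P * ((B + A) / 2)"
    using AB by (simp add: power2_eq_square add_divide_distrib distrib_left mult_ac)
  finally show "gg_sum q 0 = qpoch_inf q (q ^ 2) * ((qpoch_inf (- x) q + qpoch_inf x q) / 2)"
    unfolding A_def B_def P_def .
  have "((\<lambda>r. q ^ r / (qpoch (q ^ 2) (q ^ 2) r * qpoch q (q ^ 2) (1 + r)))
      has_sum (1 / A - 1 / B) / 2 / x) UNIV"
    using has_sum_divide_const[OF has_sum_even_odd(2)[OF euler(1) euler(2)[unfolded alt]], of x]
      qpoch_even_odd[OF q(1), of 1] x0
    by (simp add: power_mult x)
  then have "gg_sum q 1 = P ^ 2 * ((1 / A - 1 / B) / 2 / x)"
    unfolding P_def by (rule has_sum_gg_sum_eq[OF q(1)])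
  then have "x * gg_sum q 1 = P ^ 2 * ((1 / A - 1 / B) / 2)"
    using x0 by simp
  also have "\<dots> = P * ((B - A) / 2)"
    using AB by (simp add: power2_eq_square diff_divide_distrib right_diff_distrib mult_ac)
  finally show "x * gg_sum q 1 = qpoch_inf q (q ^ 2) * ((qpoch_inf (- x) q - qpoch_inf x q) / 2)"
    unfolding A_def B_def P_def .
qed

text \<open>Both products on the left are theta series in base \<open>q ^ 2\<close>, at
  \<open>x\<close> and at \<open>- x\<close>. Their even and odd terms are theta series in base
  \<open>q ^ 8\<close> at \<open>q ^ 3\<close> and, up to a factor \<open>x\<close>, at
  \<open>q ^ 7\<close>.\<close>

lemma qpoch_inf_parity_parts:
  assumes q: "norm q < 1" "q \<noteq> 0" and x: "x ^ 2 = q"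
  shows "qpoch_inf (q ^ 2) (q ^ 2) * ((qpoch_inf (- x) q + qpoch_inf x q) / 2)
           = qpochs_inf [q ^ 8, - (q ^ 3), - (q ^ 5)] (q ^ 8)"
    and "qpoch_inf (q ^ 2) (q ^ 2) * ((qpoch_inf (- x) q - qpoch_inf x q) / 2)
           = x * qpochs_inf [q ^ 8, - q, - (q ^ 7)] (q ^ 8)"
proof -
  have p: "norm (q ^ 2) < 1" "q ^ 2 \<noteq> 0" and q8: "norm (q ^ 8) < 1" "q ^ 8 \<noteq> 0"
    using q by (auto intro!: norm_power_less_1)
  have x0: "x \<noteq> 0"
    using q x by auto
  have less: "norm (w ^ n) < norm w" if "norm w < 1" "w \<noteq> 0" "n > 1" for w :: complex and n
    using that power_strict_decreasing[of 1 n "norm w"] by (simp add: norm_power)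
  have "norm x ^ 2 < 1"
    using q x by (metis norm_power)
  then have nx: "norm x < 1"
    by (simp add: power_less_one_iff)
  have qx: "q ^ 2 = x ^ 4"
    using x by (simp add: power_mult[symmetric] flip: x)
  define c where "c n = x powi n * (q ^ 2) powi (n * (n - 1) div 2)" for n :: int
  have jtp: "((\<lambda>n. z powi n * (q ^ 2) powi (n * (n - 1) div 2)) has_sum
      qpoch_inf (q ^ 2) (q ^ 2) * qpoch_inf (- z) q) UNIV" if z: "z ^ 2 = q" "norm z < 1" for z
  proof -
    have z0: "z \<noteq> 0"
      using z q by auto
    have "q ^ 2 = z ^ 4"
      by (simp add: z(1)[symmetric] power_mult[symmetric])
    then have "norm (q ^ 2) < norm z"
      using less[OF z(2) z0, of 4] by simp
    \<comment> \<open>This makes the last two products in Jacobi's formula interleave to the single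
      product \<open>(-z;q)_inf\<close>.\<close>
    moreover have "q ^ 2 / z = z * q"
      using z0 by (simp add: z(1)[symmetric] power2_eq_square)
    ultimately show ?thesis
      using jacobi_triple_product[OF p, of z] qpoch_inf_even_odd[OF q(1), of "- z"]
      by (simp add: mult.assoc)
  qed
  have A: "(c has_sum qpoch_inf (q ^ 2) (q ^ 2) * qpoch_inf (- x) q) UNIV"
    unfolding c_def by (rule jtp[OF x nx])
  have "(\<lambda>n. (- x) powi n * (q ^ 2) powi (n * (n - 1) div 2)) = (\<lambda>n. if even n then c n else - c n)"
    by (auto simp: c_def fun_eq_iff power_int_minus_left)
  then have B: "((\<lambda>n. if even n then c n else - c n) has_sum qpoch_inf (q ^ 2) (q ^ 2) * qpoch_inf x q) UNIV"
    using jtp[of "- x"] x nx by simp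
  have half: "2 * (k div 2) = k" if "even k" for k :: int
    using that by simp
  have x_even: "x powi (2 * n) = q powi n" for n
    using power_int_mult[of x 2 n] x by simp
  have even: "c (2 * n) = (q ^ 3) powi n * (q ^ 8) powi (n * (n - 1) div 2)" for n
  proof -
    have "n + 2 * (2 * n * (2 * n - 1) div 2) = 3 * n + 4 * (2 * (n * (n - 1) div 2))"
      by (subst (1 2) half) (auto simp: algebra_simps)
    then have "n + 2 * (2 * n * (2 * n - 1) div 2) = 3 * n + 8 * (n * (n - 1) div 2)"
      by linarith
    then show ?thesis
      using q by (simp only: c_def x_even power_int_power of_nat_numeral power_int_add[symmetric]
          simp_thms)
  qed
  have odd: "c (2 * n + 1) = x * ((q ^ 7) powi n * (q ^ 8) powi (n * (n - 1) div 2))" for n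
  proof -
    have "n + 2 * ((2 * n + 1) * (2 * n + 1 - 1) div 2) = 7 * n + 4 * (2 * (n * (n - 1) div 2))"
      by (subst (1 2) half) (auto simp: algebra_simps)
    then have "n + 2 * ((2 * n + 1) * (2 * n + 1 - 1) div 2) = 7 * n + 8 * (n * (n - 1) div 2)"
      by linarith
    moreover have "x powi (2 * n + 1) = x * q powi n"
      using x0 x_even[of n] by (simp add: power_int_add)
    ultimately show ?thesis
      using q by (simp only: c_def power_int_power of_nat_numeral power_int_add[symmetric]
          simp_thms mult.assoc)
  qed
  have "norm (q ^ 8) < norm (q ^ 3)"
    using power_strict_decreasing[of 3 8 "norm q"] q by (simp add: norm_power)
  moreover have "q ^ 8 / q ^ 3 = q ^ 5"
    using q by (simp add: power_diff[symmetric])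
  ultimately have "((\<lambda>n. c (2 * n)) has_sum qpochs_inf [q ^ 8, - (q ^ 3), - (q ^ 5)] (q ^ 8)) UNIV"
    using jacobi_triple_product[OF q8, of "q ^ 3"] by (simp add: even qpochs_inf_def mult.assoc)
  from has_sum_unique[OF has_sum_even_odd(1)[OF A B] this]
  show "qpoch_inf (q ^ 2) (q ^ 2) * ((qpoch_inf (- x) q + qpoch_inf x q) / 2)
      = qpochs_inf [q ^ 8, - (q ^ 3), - (q ^ 5)] (q ^ 8)"
    by (simp add: distrib_left)
  have "norm (q ^ 8) < norm (q ^ 7)"
    using power_strict_decreasing[of 7 8 "norm q"] q by (simp add: norm_power)
  moreover have "q ^ 8 / q ^ 7 = q"
    using q by (simp add: power_diff[symmetric])
  ultimately have "((\<lambda>n. (q ^ 7) powi n * (q ^ 8) powi (n * (n - 1) div 2))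
      has_sum qpochs_inf [q ^ 8, - q, - (q ^ 7)] (q ^ 8)) UNIV"
    using jacobi_triple_product[OF q8, of "q ^ 7"] by (simp add: qpochs_inf_def mult_ac)
  then have "((\<lambda>n. c (2 * n + 1)) has_sum x * qpochs_inf [q ^ 8, - q, - (q ^ 7)] (q ^ 8)) UNIV"
    unfolding odd by (rule has_sum_cmult_right)
  from has_sum_unique[OF has_sum_even_odd(2)[OF A B] this]
  show "qpoch_inf (q ^ 2) (q ^ 2) * ((qpoch_inf (- x) q - qpoch_inf x q) / 2)
      = x * qpochs_inf [q ^ 8, - q, - (q ^ 7)] (q ^ 8)"
    by (simp add: right_diff_distrib)
qed

text \<open>Euler's \<open>(-q;q)_inf (q;q^2)_inf = 1\<close>, together with the leading factor
  \<open>1 - (-1) = 2\<close>.\<close>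

lemma qpoch_inf_minus_one:
  assumes q: "norm q < 1"
  shows "qpoch_inf (- 1) q * qpoch_inf q (q ^ 2) = 2"
proof -
  have p: "norm (q ^ 2) < 1"
    using q by (intro norm_power_less_1) auto
  have "qpoch_inf q q = qpoch_inf q (q ^ 2) * qpoch_inf (q ^ 2) (q ^ 2)"
    using qpoch_inf_even_odd[OF q, of q] by (simp add: power2_eq_square)
  moreover have "qpoch_inf q q * qpoch_inf (- q) q = qpoch_inf (q ^ 2) (q ^ 2)"
    by (rule qpoch_inf_mult_minus[OF q])
  ultimately have "qpoch_inf (- q) q * qpoch_inf q (q ^ 2) = 1"
    using qpoch_inf_nonzero'[OF p p] by (simp add: mult_ac) 
  then show ?thesis
    using qpoch_inf_rec[OF q, of "- 1"] by simp
qed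

section \<open>The triple series\<close>

text \<open>The summands of the two identities are the cases \<open>e = 0\<close> and \<open>e = 1\<close>.\<close>

definition triple_term :: "complex \<Rightarrow> nat \<Rightarrow> nat \<Rightarrow> nat \<times> nat \<times> nat \<Rightarrow> complex" where
  "triple_term q m e = (\<lambda>(j, k, l).
     qpoch q (q ^ 2) k * (-1) ^ k
       / (qpoch q q (e + 2 * j) * qpoch (q ^ 2) (q ^ 2) k * qpoch (q ^ 2) (q ^ 2) l)
       * q powi ((int e + 2 * int j + int k + int l) * (int e + 2 * int j + int k + int l - 1)
                  + int l ^ 2 + int j + int k - int m * (int e + 2 * int j + 2 * int l)))"

lemma two_times_choose_two: "2 * int (n choose 2) = int n * (int n - 1)"
  by (simp add: int_choose_two)

text \<open>With \<open>N = e + 2 * j + l\<close> one has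
  \<open>(N + k) * (N + k - 1) + k = N * (N - 1) + k ^ 2 + 2 * k * N\<close> and
  \<open>l ^ 2 = l * (l - 1) + l\<close>, so \<open>k\<close> meets the other indices only through
  \<open>N\<close>.\<close>

lemma triple_term_eq:
  assumes "q \<noteq> 0"
  shows "triple_term q m e (j, k, l)
    = q powi (int (j + l) - int m * int (e + 2 * (j + l)))
      * (mix_coeff q (e + 2 * j) l * gg_term q (e + 2 * j + l) k)"
proof -
  have "(int e + 2 * int j + int k + int l) * (int e + 2 * int j + int k + int l - 1)
      + int l ^ 2 + int j + int k - int m * (int e + 2 * int j + 2 * int l)
    = int (j + l) - int m * int (e + 2 * (j + l))
      + int (2 * (e + 2 * j + l choose 2) + 2 * (l choose 2))
      + int (k ^ 2 + 2 * k * (e + 2 * j + l))"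
    unfolding of_nat_add of_nat_mult of_nat_numeral two_times_choose_two
    by (simp add: algebra_simps power2_eq_square)
  then show ?thesis
    using assms
    by (simp only: triple_term_def prod.case mix_coeff_def gg_term_def power_int_add simp_thms
        power_int_of_nat) (simp add: mult_ac)
qed

text \<open>The exponent has negative linear parts in \<open>j\<close> and \<open>l\<close>.
  Dropping nonnegative summands leaves an exponent that separates the indices, so the majorant is a
  product of three Gaussian series.\<close>

lemma triple_term_summable:
  assumes q: "norm q < 1" "q \<noteq> 0"
  shows "triple_term q m e summable_on UNIV"
proof -
  have p: "norm (q ^ 2) < 1"
    using q by (intro norm_power_less_1) auto
  define r where "r = norm q"
  have r: "0 < r" "r < 1"
    using q by (auto simp: r_def)
  obtain C where C: "C > 0" "\<And>k. norm (qpoch q (q ^ 2) k) \<le> C"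
    using qpoch_bounded[OF p q(1)] by blast
  obtain D where D: "D > 0" "\<And>k. norm (1 / qpoch (q ^ 2) (q ^ 2) k) \<le> D"
    using inverse_qpoch_bounded[OF p p] by blast
  obtain D' where D': "D' > 0" "\<And>k. norm (1 / qpoch q q k) \<le> D'"
    using inverse_qpoch_bounded[OF q(1) q(1)] by blast
  define s where "s = r powi (- 2 * int m)"
  define K where "K = C * D' * D * D * r powi (- int m * int e)"
  define G where "G s n = s ^ n * (r ^ 2) ^ (n choose 2)" for s :: real and n
  have nonneg: "s \<ge> 0" "K \<ge> 0" "G s n \<ge> 0" "G 1 n \<ge> 0" for n
    using r C D D' by (auto simp: s_def K_def G_def)
  have "r ^ 2 < 1"
    using r by (simp add: power_less_one_iff)
  then have "(\<lambda>n. norm (complex_of_real (G t n))) summable_on UNIV" if "t \<ge> 0" for t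
    using summable_gaussian[of "r ^ 2" t] that r
    by (intro summable_on_nat) (simp_all add: G_def norm_mult norm_power)
  from this[OF nonneg(1)] this[of 1]
  have G: "(\<lambda>n. norm (complex_of_real (G s n))) summable_on UNIV"
    "(\<lambda>n. norm (complex_of_real (G 1 n))) summable_on UNIV"
    by simp_all
  have "(\<lambda>(j, k, l). norm (complex_of_real (G s j) * (complex_of_real (G 1 k) * complex_of_real (G s l))))
      summable_on UNIV \<times> (UNIV \<times> UNIV)"
    using summable_norm_on_times[OF G(1), of "\<lambda>(k, l). complex_of_real (G 1 k) * complex_of_real (G s l)"
        "UNIV \<times> UNIV"]
      summable_norm_on_times[OF G(2) G(1)]
    by (simp add: case_prod_unfold)
  then have "(\<lambda>z. K * (case z of (j, k, l) \<Rightarrow> G s j * (G 1 k * G s l))) summable_on UNIV"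
    using nonneg by (intro summable_on_cmult_right) (simp add: norm_mult case_prod_unfold)
  then have "(\<lambda>z. norm (triple_term q m e z)) summable_on UNIV"
  proof (rule summable_on_comparison_test)
    fix z :: "nat \<times> nat \<times> nat"
    obtain j k l where z: "z = (j, k, l)"
      by (cases z)
    define E where "E = (int e + 2 * int j + int k + int l) * (int e + 2 * int j + int k + int l - 1)
        + int l ^ 2 + int j + int k - int m * (int e + 2 * int j + 2 * int l)"
    \<comment> \<open>The separated lower bound for \<open>E\<close>; the linear parts
      \<open>- 2 * m * j\<close> and \<open>- 2 * m * l\<close> go into the base \<open>s\<close>,
      which may exceed 1.\<close>
    define E' where "E' = - int m * int e + (- 2 * int m * int j + int (2 * (j choose 2)))
        + (int (2 * (k choose 2)) + (- 2 * int m * int l + int (2 * (l choose 2))))"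
    have "E = E' + (int (e + j + l) * (int (e + j + l) - 1) + int (2 * (e + j + l) * (j + k) + 2 * j * k + l + j + k))"
      unfolding E_def E'_def of_nat_add of_nat_mult of_nat_numeral two_times_choose_two
      by (simp add: algebra_simps power2_eq_square)
    moreover have "int (e + j + l) * (int (e + j + l) - 1) \<ge> 0"
      by (metis two_times_choose_two of_nat_0_le_iff zero_le_mult_iff zero_le_numeral)
    ultimately have "E' \<le> E"
      by linarith
    have "norm (triple_term q m e z)
        = norm (qpoch q (q ^ 2) k) * norm (1 / qpoch q q (e + 2 * j)) * norm (1 / qpoch (q ^ 2) (q ^ 2) k)
          * norm (1 / qpoch (q ^ 2) (q ^ 2) l) * r powi E"
      by (simp add: z triple_term_def E_def r_def norm_mult norm_divide norm_power norm_power_int)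
    also have "\<dots> \<le> C * D' * D * D * r powi E'"
      using r C D D' \<open>E' \<le> E\<close>
      by (intro mult_mono C D D' power_int_decreasing) auto
    also have "r powi E' = r powi (- int m * int e) * (G s j * (G 1 k * G s l))"
    proof -
      have add: "r powi (a + b) = r powi a * r powi b" for a b
        using r by (simp add: power_int_add)
      have "G s n = r powi (- 2 * int m * int n) * r powi int (2 * (n choose 2))"
        "G 1 n = r powi int (2 * (n choose 2))" for n
        unfolding G_def s_def power_int_power' power_mult[symmetric] power_int_of_nat by simp_all
      then show ?thesis
        unfolding E'_def by (simp only: add mult.assoc)
    qed
    finally show "norm (triple_term q m e z) \<le> K * (case z of (j, k, l) \<Rightarrow> G s j * (G 1 k * G s l))"
      by (simp add: z K_def mult.assoc)
  qed auto
  then show ?thesis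
    by (rule abs_summable_summable)
qed

lemma triple_term_has_sum:
  assumes q: "norm q < 1" "q \<noteq> 0" and e: "e < 2"
  shows "(triple_term q m e has_sum gg_sum q e * qpoch_inf (- (q powi (- int m))) q / 2) UNIV"
proof -
  define S where "S = infsum (triple_term q m e) UNIV"
  have S: "(triple_term q m e has_sum S) UNIV"
    unfolding S_def by (intro has_sum_infsum triple_term_summable q)
  define w where "w J = q powi (int J - int m * int (e + 2 * J))" for J
  have inner: "((\<lambda>k. triple_term q m e (J - l, k, l)) has_sum
      w J * (mix_coeff q (e + 2 * (J - l)) l * gg_sum q (e + 2 * (J - l) + l))) UNIV"
    if "l \<le> J" for J l
    unfolding triple_term_eq[OF q(2)] le_add_diff_inverse2[OF that] w_def
    by (intro has_sum_cmult_right gg_term_has_sum q)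
  \<comment> \<open>Regrouping by \<open>J = j + l\<close> is a bijection onto the triples with
    \<open>l \<le> J\<close>.\<close>
  have "((\<lambda>((J, l), k). triple_term q m e (J - l, k, l)) has_sum S) (Sigma UNIV atMost \<times> UNIV)"
    by (rule has_sum_reindex_bij_witness[of UNIV "\<lambda>((J, l), k). (J - l, k, l)"
          "\<lambda>(j, k, l). ((j + l, l), k)", THEN iffD1, OF _ _ _ _ _ refl S]) auto
  then have "((\<lambda>(J, l). w J * (mix_coeff q (e + 2 * (J - l)) l * gg_sum q (e + 2 * (J - l) + l)))
      has_sum S) (Sigma UNIV atMost)"
    by (rule has_sum_SigmaD) (use inner in auto)
  then have "((\<lambda>J. w J * mix_sum q e J) has_sum S) UNIV"
    by (rule has_sum_SigmaD) (simp add: mix_sum_def sum_distrib_left has_sum_finite)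
  moreover define z where "z = q powi (- int m)"
  have "w J * mix_sum q e J
      = gg_sum q e * (q ^ (e + 2 * J choose 2) / qpoch q q (e + 2 * J) * z ^ (e + 2 * J))" for J
  proof -
    \<comment> \<open>With this, \<open>e + 2 * J choose 2\<close> equals
      \<open>J + 4 * (J choose 2) + 2 * e * J\<close>, the exponent that Euler's series
      needs.\<close>
    have "int e * (int e - 1) = 0"
      using e by (auto simp: less_Suc_eq numeral_2_eq_2)
    then have "2 * int (e + 2 * J choose 2) = 2 * (int J + 2 * (2 * int (J choose 2)) + int (2 * e * J))"
      unfolding two_times_choose_two of_nat_add of_nat_mult of_nat_numeral
      by (simp add: algebra_simps)
    then have "int J - int m * int (e + 2 * J) + int (4 * (J choose 2) + 2 * e * J)
        = int (e + 2 * J choose 2) + (- int m * int (e + 2 * J))"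
      by simp
    then have "w J * q ^ (4 * (J choose 2) + 2 * e * J) = q ^ (e + 2 * J choose 2) * z ^ (e + 2 * J)"
      using q unfolding w_def z_def power_int_power' power_int_mult[symmetric] power_int_of_nat[symmetric]
      by (simp only: power_int_add[symmetric] simp_thms)
    then show ?thesis
      by (simp add: mix_sum_eq[OF q(1) e] mult_ac)
  qed
  moreover have "((\<lambda>J. q ^ (e + 2 * J choose 2) / qpoch q q (e + 2 * J) * z ^ (e + 2 * J))
      has_sum qpoch_inf (- z) q / 2) UNIV"
  proof -
    \<comment> \<open>Hence Euler's series at \<open>- z\<close> sums to 0, and the even and odd
      parts at \<open>z\<close> both equal half of the full sum.\<close>
    have "z * q ^ m = 1"
      using q by (simp add: z_def power_int_minus)
    then have "qpoch_inf z q = 0"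
      by (rule qpoch_inf_eq_0[OF q(1)])
    then have "((\<lambda>n. q ^ (n choose 2) / qpoch q q n * (- z) ^ n) has_sum 0) UNIV"
      using euler_qexp[OF q(1), of "- z"] by simp
    moreover have "(\<lambda>n. q ^ (n choose 2) / qpoch q q n * (- z) ^ n)
        = (\<lambda>n. if even n then q ^ (n choose 2) / qpoch q q n * z ^ n
                else - (q ^ (n choose 2) / qpoch q q n * z ^ n))"
      by (auto simp: fun_eq_iff)
    ultimately have alt: "((\<lambda>n. if even n then q ^ (n choose 2) / qpoch q q n * z ^ n
                else - (q ^ (n choose 2) / qpoch q q n * z ^ n)) has_sum 0) UNIV"
      by simp
    have "e = 0 \<or> e = 1"
      using e by auto
    then show ?thesis
      using has_sum_even_odd[OF euler_qexp[OF q(1), of z] alt] by auto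
  qed
  ultimately have "S = gg_sum q e * (qpoch_inf (- z) q / 2)"
    by (simp only:) (rule has_sum_unique, assumption, rule has_sum_cmult_right)
  with S show ?thesis
    by (simp add: z_def)
qed

text \<open>For \<open>q = 0\<close> and \<open>m > 0\<close> the negative powers of
  \<open>q\<close> have no meaning (\<open>powi\<close> would return 0), which is why that case is
  excluded. The sums are unconditional over all triples.\<close>

theorem theorem4p2:
  fixes q :: complex and m :: nat
  assumes "norm q < 1"
    and "q \<noteq> 0 \<or> m = 0"
  shows "((\<lambda>(j::nat, k::nat, l::nat).
            qpoch q (q ^ 2) k * (-1) ^ k
              / (qpoch q q (2 * j) * qpoch (q ^ 2) (q ^ 2) k * qpoch (q ^ 2) (q ^ 2) l)
              * q powi ((2 * int j + int k + int l) * (2 * int j + int k + int l - 1)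
                         + int l ^ 2 + int j + int k - 2 * int m * (int j + int l)))
          has_sum
            (qpoch (- (q powi (- int m))) q m * qpochs_inf [q ^ 8, - (q ^ 3), - (q ^ 5)] (q ^ 8)
              / qpoch_inf (q ^ 2) (q ^ 2))) UNIV
       \<and> ((\<lambda>(j::nat, k::nat, l::nat).
            qpoch q (q ^ 2) k * (-1) ^ k
              / (qpoch q q (1 + 2 * j) * qpoch (q ^ 2) (q ^ 2) k * qpoch (q ^ 2) (q ^ 2) l)
              * q powi ((1 + 2 * int j + int k + int l) * (2 * int j + int k + int l)
                         + int l ^ 2 + int j + int k - int m * (1 + 2 * int j + 2 * int l)))
          has_sum
            (qpoch (- (q powi (- int m))) q m * qpochs_inf [q ^ 8, - q, - (q ^ 7)] (q ^ 8)
              / qpoch_inf (q ^ 2) (q ^ 2))) UNIV"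
    (is "(?f has_sum ?a) UNIV \<and> (?g has_sum ?b) UNIV")
proof -
  have f: "?f = triple_term q m 0" and g: "?g = triple_term q m 1"
    by (simp_all add: triple_term_def fun_eq_iff algebra_simps)
  show ?thesis
  proof (cases "q = 0")
    case True
    with assms have m: "m = 0"
      by simp
    have single: "(triple_term 0 0 e has_sum 1) UNIV" if "e < 2" for e
    proof -
      \<comment> \<open>At \<open>q = 0\<close> only a vanishing exponent survives; away from the
        origin the exponent is positive.\<close>
      have "triple_term 0 0 e z = 0" if "z \<noteq> (0, 0, 0)" for z
      proof -
        obtain j k l where z: "z = (j, k, l)"
          by (cases z)
        define N where "N = int (e + 2 * j + k + l)"
        have "N * (N - 1) \<ge> 0"
          unfolding N_def by (metis two_times_choose_two of_nat_0_le_iff mult_nonneg_nonneg zero_le_numeral)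
        moreover have "int l ^ 2 + int j + int k > 0"
          using that z by (cases "l = 0") (auto simp: add_pos_nonneg)
        ultimately have "N * (N - 1) + int l ^ 2 + int j + int k \<noteq> 0"
          by linarith
        then show ?thesis
          by (simp add: z triple_term_def N_def)
      qed
      moreover have "triple_term 0 0 e (0, 0, 0) = 1"
      proof -
        have "e = 0 \<or> e = 1"
          using \<open>e < 2\<close> by auto
        then show ?thesis
          using qpoch_Suc[of 0 0 0] by (auto simp: triple_term_def)
      qed
      ultimately have "(triple_term 0 0 e has_sum 1) UNIV \<longleftrightarrow> (triple_term 0 0 e has_sum 1) {(0, 0, 0)}"
        by (intro has_sum_cong_neutral) auto
      then show ?thesis
        using has_sum_finite[of "{(0, 0, 0)}" "triple_term 0 0 e"] \<open>triple_term 0 0 e (0, 0, 0) = 1\<close>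
        by simp
    qed
    \<comment> \<open>Ensures that the quotient defining \<open>qpoch (- 1) 0 0\<close> is 1 and not
      a division by zero.\<close>
    have "qpoch_inf (- 1) 0 \<noteq> 0"
      by (rule qpoch_inf_nonzero) (auto simp: power_0_left)
    then have "?a = 1" "?b = 1"
      by (simp_all add: True m qpochs_inf_def qpoch_def)
    then show ?thesis
      unfolding f g using single[of 0] single[of 1] by (simp add: True m)
  next
    case False
    define x where "x = csqrt q"
    have x: "x ^ 2 = q" "x \<noteq> 0"
      using False by (auto simp: x_def)
    define P where "P = qpoch_inf (q ^ 2) (q ^ 2)"
    have P: "P \<noteq> 0"
      unfolding P_def using assms by (intro qpoch_inf_nonzero' norm_power_less_1) auto
    define z where "z = q powi (- int m)"
    have "z * q ^ m = 1"
      using False by (simp add: z_def power_int_minus)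
    \<comment> \<open>The tail of the quotient starts at \<open>- z * q ^ m = - 1\<close>; this
      \<open>(-1;q)_inf\<close> absorbs the halves through
      \<open>qpoch_inf_minus_one\<close>.\<close>
    then have "qpoch (- z) q m = qpoch_inf (- z) q / qpoch_inf (- 1) q"
      by (simp add: qpoch_def)
    moreover have "qpoch_inf q (q ^ 2) = 2 / qpoch_inf (- 1) q"
      using qpoch_inf_minus_one[OF assms(1)] by (metis mult_zero_left nonzero_mult_div_cancel_left zero_neq_numeral)
    ultimately have z: "qpoch_inf q (q ^ 2) * qpoch_inf (- z) q / 2 = qpoch (- z) q m"
      by simp
    note gg = gg_sum_eq[OF assms(1) False x(1)]
    note parts = qpoch_inf_parity_parts[OF assms(1) False x(1), folded P_def]
    have "gg_sum q 0 * qpoch_inf (- z) q / 2 = ?a"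
      using P unfolding gg parts[symmetric] z_def[symmetric] P_def[symmetric] z[symmetric] by simp
    moreover
    \<comment> \<open>The odd part is known only with its factor \<open>x\<close>, which is nonzero
      and cancelled afterwards.\<close>
    have "x * (gg_sum q 1 * qpoch_inf (- z) q / 2) = x * ?b"
    proof -
      have "x * (gg_sum q 1 * qpoch_inf (- z) q / 2) = x * gg_sum q 1 * (qpoch_inf (- z) q / 2)"
        by simp
      also have "\<dots> = qpoch_inf q (q ^ 2) * qpoch_inf (- z) q / 2
          * ((qpoch_inf (- x) q - qpoch_inf x q) / 2)"
        unfolding gg(2) by (simp only: mult.assoc times_divide_eq_left times_divide_eq_right mult.left_commute mult.commute)
      also have "\<dots> = qpoch (- z) q m * (x * qpochs_inf [q ^ 8, - q, - (q ^ 7)] (q ^ 8) / P)"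
        unfolding z parts(2)[symmetric] using P by simp
      finally show ?thesis
        by (simp add: z_def P_def)
    qed
    with x have "gg_sum q 1 * qpoch_inf (- z) q / 2 = ?b"
      by (simp only: mult_cancel_left simp_thms)
    ultimately show ?thesis
      unfolding f g using triple_term_has_sum[OF assms(1) False, of 0 m]
        triple_term_has_sum[OF assms(1) False, of 1 m]
      unfolding z_def by simp
  qed
qed

end
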